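(* The product of polymorphisms is associative: for any Lebesgue spaces $(A,\alpha)$, $(B,\beta)$, $(C,\gamma)$, $(D,\delta)$ and any polymorphisms $\mathfrak P\in\mathrm{Pol}(A,B)$, $\mathfrak Q\in\mathrm{Pol}(B,C)$, $\mathfrak T\in\mathrm{Pol}(C,D)$, $$(\mathfrak T\circ\mathfrak Q)\circ\mathfrak P=\mathfrak T\circ(\mathfrak Q\circ\mathfrak P).$$
   Context: A Lebesgue space $(A,\alpha)$ is a space with a finite positive measure, $\alpha(A)>0$, isomorphic to a disjoint union of a finite (possibly empty) segment with Lebesgue measure and an at most countable collection of atoms. $\mathbb R^\times$ is the multiplicative group of positive reals, with coordinate $t$. $\mathcal M^{\triangledown}$ is the set of positive measures $\mu$ on $\mathbb R^\times$ with $\int d\mu<\infty$ and $\int t\,d\mu(t)<\infty$; it is closed under addition and under the convolution $\int f\,d(\mu*\nu)=\iint f(s_1s_2)\,d\mu(s_1)\,d\nu(s_2)$. A polymorphism from $(A,\alpha)$ to $(B,\beta)$ is a measure $\mathfrak P$ on $A\times B\times\mathbb R^\times$ such that the image of $\mathfrak P$ under the projection to $A$ is $\alpha$ and the image of $t\cdot\mathfrak P$ under the projection to $B$ is $\beta$. $\mathrm{Pol}(A,B)$ is the set of all polymorphisms. For measurable $M\subset A$, $N\subset B$, $\mathfrak p[M\times N]\in\mathcal M^{\triangledown}$ is the image of the restriction of $\mathfrak P$ to $M\times N\times\mathbb R^\times$ under the projection to $\mathbb R^\times$; similarly $\mathfrak q[\cdot]$ for $\mathfrak Q$, etc. Product.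 Let $\mathfrak P\in\mathrm{Pol}(A,B)$, $\mathfrak Q\in\mathrm{Pol}(B,C)$. For measurable $M\subset A$ and $K\subset C$ there are measures $\mathfrak p_{M,b}$, $\mathfrak q_{b,K}\in\mathcal M^{\triangledown}$, defined for $\beta$-almost all $b\in B$, such that for every measurable $N\subset B$ one has $\mathfrak p[M\times N]=\int_N\mathfrak p_{M,b}\,d\beta(b)$ and $\mathfrak q[N\times K]=\int_N\mathfrak q_{b,K}\,d\beta(b)$. The product $\mathfrak R=\mathfrak Q\circ\mathfrak P\in\mathrm{Pol}(A,C)$ is the (well-defined) polymorphism determined by $\mathfrak r[M\times K]=\int_B\mathfrak q_{b,K}*\mathfrak p_{M,b}\,d\beta(b)$ for all measurable $M\subset A$, $K\subset C$. *)

theory Defs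
  imports "HOL-Analysis.Analysis"
begin

(* The disjoint union of the segment [u,v] with Lebesgue measure and of point atoms,
   indexed by I, of masses w i. The segment is empty when v < u. *)
definition segment_with_atoms :: "real \<Rightarrow> real \<Rightarrow> nat set \<Rightarrow> (nat \<Rightarrow> ennreal) \<Rightarrow> (real + nat) measure" where
  "segment_with_atoms u v I w =
     measure_of ({u..v} <+> I)
       {X. X \<subseteq> {u..v} <+> I \<and> Inl -` X \<in> sets lebesgue}
       (\<lambda>X. emeasure lebesgue (Inl -` X) + emeasure (point_measure I w) (Inr -` X))"

definition isomorphic_mod_0 :: "'a measure \<Rightarrow> 'b measure \<Rightarrow> bool" where
  "isomorphic_mod_0 M N \<longleftrightarrow>
     (\<exists>X\<in>null_sets M. \<exists>Y\<in>null_sets N.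
        let M' = restrict_space M (space M - X); N' = restrict_space N (space N - Y) in
        \<exists>f g. f \<in> measurable M' N' \<and> g \<in> measurable N' M' \<and>
          (\<forall>x\<in>space M'. g (f x) = x) \<and> (\<forall>y\<in>space N'. f (g y) = y) \<and>
          distr M' N' f = N')"

(* Passing to the completion admits both conventions for the sigma-algebra of a Lebesgue
   space: complete (as in Rokhlin) and standard Borel. It changes nothing if A is complete. *)
definition lebesgue_measure_space :: "'a measure \<Rightarrow> bool" where
  "lebesgue_measure_space A \<longleftrightarrow>
     finite_measure A \<and> emeasure A (space A) > 0 \<and>
     (\<exists>u v I w. (\<forall>i\<in>I. 0 < w i) \<and>
        isomorphic_mod_0 (completion A) (segment_with_atoms u v I w))"

abbreviation pos_reals :: "real measure" where
  "pos_reals \<equiv> restrict_space borel {0<..}"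

definition M_tri :: "real measure set" where
  "M_tri = {\<mu>. sets \<mu> = sets pos_reals \<and> emeasure \<mu> (space \<mu>) < \<infinity> \<and>
                 (\<integral>\<^sup>+t. ennreal t \<partial>\<mu>) < \<infinity>}"

definition mult_convolution :: "real measure \<Rightarrow> real measure \<Rightarrow> real measure" where
  "mult_convolution \<mu> \<nu> = distr (\<mu> \<Otimes>\<^sub>M \<nu>) pos_reals (\<lambda>(s1, s2). s1 * s2)"

definition Pol :: "'a measure \<Rightarrow> 'b measure \<Rightarrow> ('a \<times> 'b \<times> real) measure set" where
  "Pol A B = {P. sets P = sets (A \<Otimes>\<^sub>M B \<Otimes>\<^sub>M pos_reals) \<and>
     distr P A (\<lambda>(a, b, t). a) = A \<and>
     distr (density P (\<lambda>(a, b, t). ennreal t)) B (\<lambda>(a, b, t). b) = B}"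

(* The measure written p[M x N], for the polymorphism P. *)
definition slice :: "('a \<times> 'b \<times> real) measure \<Rightarrow> 'a set \<Rightarrow> 'b set \<Rightarrow> real measure" where
  "slice P M N = distr (restrict_space P (M \<times> N \<times> {0<..})) pos_reals (\<lambda>(a, b, t). t)"

(* m N = (integral over N of k b with respect to B) for all measurable N, as measures on the
   positive reals. The values of k on a null set of points b are irrelevant. *)
definition measure_family :: "'b measure \<Rightarrow> ('b set \<Rightarrow> real measure) \<Rightarrow> ('b \<Rightarrow> real measure) \<Rightarrow> bool" where
  "measure_family B m k \<longleftrightarrow>
     (AE b in B. k b \<in> M_tri) \<and>
     (\<forall>S\<in>sets pos_reals. (\<lambda>b. emeasure (k b) S) \<in> borel_measurable B) \<and>
     (\<forall>N\<in>sets B. \<forall>S\<in>sets pos_reals.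
        emeasure (m N) S = (\<integral>\<^sup>+b\<in>N. emeasure (k b) S \<partial>B))"

definition is_pol_product ::
  "'a measure \<Rightarrow> 'b measure \<Rightarrow> 'c measure \<Rightarrow> ('b \<times> 'c \<times> real) measure \<Rightarrow> ('a \<times> 'b \<times> real) measure
    \<Rightarrow> ('a \<times> 'c \<times> real) measure \<Rightarrow> bool" where
  "is_pol_product A B C Q P R \<longleftrightarrow> R \<in> Pol A C \<and>
     (\<forall>M\<in>sets A. \<forall>K\<in>sets C. \<exists>p q.
        measure_family B (\<lambda>N. slice P M N) p \<and>
        measure_family B (\<lambda>N. slice Q N K) q \<and>
        (\<forall>S\<in>sets pos_reals.
           emeasure (slice R M K) S = (\<integral>\<^sup>+b. emeasure (mult_convolution (q b) (p b)) S \<partial>B)))"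

(* The product of Q in Pol B C and P in Pol A B, with P applied first. *)
definition pol_product ::
  "'a measure \<Rightarrow> 'b measure \<Rightarrow> 'c measure \<Rightarrow> ('b \<times> 'c \<times> real) measure \<Rightarrow> ('a \<times> 'b \<times> real) measure
    \<Rightarrow> ('a \<times> 'c \<times> real) measure" where
  "pol_product A B C Q P = (THE R. is_pol_product A B C Q P R)"

lemma
  shows space_segment_with_atoms: "space (segment_with_atoms u v I w) = {u..v} <+> I"
    and sets_segment_with_atoms:
      "sets (segment_with_atoms u v I w) = {X. X \<subseteq> {u..v} <+> I \<and> Inl -` X \<in> sets lebesgue}"
    and emeasure_segment_with_atoms:
      "X \<in> sets (segment_with_atoms u v I w) \<Longrightarrow>
         emeasure (segment_with_atoms u v I w) X =
         emeasure lebesgue (Inl -` X) + emeasure (point_measure I w) (Inr -` X)"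
proof -
  let ?Om = "{u..v} <+> I"
  let ?S = "{X. X \<subseteq> ?Om \<and> Inl -` X \<in> sets lebesgue}"
  let ?m = "\<lambda>X. emeasure lebesgue (Inl -` X) + emeasure (point_measure I w) (Inr -` X)"
  have vOm: "Inl -` ?Om = {u..v}" by auto
  have sa: "sigma_algebra ?Om ?S"
  proof (rule sigma_algebra_iff2[THEN iffD2], intro conjI ballI allI impI)
    fix X assume "X \<in> ?S"
    then show "?Om - X \<in> ?S" by (auto simp: vimage_Diff vOm)
  next
    fix F :: "nat \<Rightarrow> _" assume "range F \<subseteq> ?S"
    then show "(\<Union>i. F i) \<in> ?S" by (auto simp: vimage_UN)
  qed auto
  then interpret sigma_algebra ?Om ?S .
  have ca: "countably_additive ?S ?m"
  proof (rule countably_additiveI)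
    fix F :: "nat \<Rightarrow> _" assume F: "range F \<subseteq> ?S" "disjoint_family F"
    have disj: "disjoint_family (\<lambda>i. Inl -` F i)" "disjoint_family (\<lambda>i. Inr -` F i)"
      using F(2) unfolding disjoint_family_on_def by blast+
    have "(\<Sum>i. ?m (F i)) =
      (\<Sum>i. emeasure lebesgue (Inl -` F i)) + (\<Sum>i. emeasure (point_measure I w) (Inr -` F i))"
      by (rule suminf_add[symmetric]) auto
    also have "(\<Sum>i. emeasure lebesgue (Inl -` F i)) = emeasure lebesgue (\<Union>i. Inl -` F i)"
      using F(1) by (intro suminf_emeasure disj) auto
    also have "(\<Sum>i. emeasure (point_measure I w) (Inr -` F i)) =
        emeasure (point_measure I w) (\<Union>i. Inr -` F i)"
      using F(1) by (intro suminf_emeasure disj) (auto simp: sets_point_measure)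
    finally show "(\<Sum>i. ?m (F i)) = ?m (\<Union>i. F i)" by (simp add: vimage_UN)
  qed
  show "space (segment_with_atoms u v I w) = ?Om"
    unfolding segment_with_atoms_def by (rule space_measure_of) auto
  show s: "sets (segment_with_atoms u v I w) = ?S"
    unfolding segment_with_atoms_def by (rule sets_measure_of_eq)
  show "X \<in> sets (segment_with_atoms u v I w) \<Longrightarrow> emeasure (segment_with_atoms u v I w) X = ?m X"
    unfolding s unfolding segment_with_atoms_def
    by (rule emeasure_measure_of_sigma[OF sa _ ca]) (auto simp: positive_def)
qed

end

theory Submission
  imports Defs "HOL-Probability.Probability"
begin

text \<open>
  In terms of fibres, the product \<open>Q \<circ> P\<close> is the law of \<open>(a, c, s t)\<close>, where \<open>(a, b, t)\<close> and \<open>(b, c, s)\<close>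
  are drawn from \<open>P\<close> and \<open>Q\<close> with a common point \<open>b\<close>. Associativity then says that
  three such steps can be chained in either order, and that multiplication of the factors is
  associative.

  To make this precise, fix sets \<open>M\<close> in \<open>A\<close> and \<open>L\<close> in \<open>D\<close>, let \<open>p b\<close> be the fibres over \<open>B\<close> of the part of
  \<open>P\<close> over \<open>M\<close>, and \<open>\<tau> c\<close> the fibres over \<open>C\<close> of the part of \<open>T\<close> over \<open>L\<close>. A product can be evaluated with the
  fibres of just one factor by integrating over the other factor itself
  (\<open>nn_integral_convolution_of_fibres\<close>, \<open>nn_integral_pol_product_target\<close> and
  \<open>nn_integral_pol_product_source\<close>). Applying this twice to each bracketing leads to the same expression,
  an integral over the middle factor \<open>Q\<close> in which \<open>p b\<close> and \<open>\<tau> c\<close> are convolved with the point mass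
  at \<open>s\<close>; the order of the last two integrations is exchanged by Fubini
  (\<open>is_pol_product_assoc\<close>).

  The remaining work is to show that the products exist and are unique, so that the definite
  description denotes them. Uniqueness holds because fibres are determined almost everywhere
  (\<open>measure_family_unique\<close>) and finite measures are determined by rectangles. For existence, the fibres over
  \<open>B\<close> come from a disintegration theorem for finite measures on a product with a real line or half-line,
  proved by conditional quantiles (\<open>disintegration_unit_interval\<close>), and the hypothesis that the
  target is a Lebesgue space enters through a real coordinate on it
  (\<open>lebesgue_measure_space_coordinate\<close>, \<open>is_pol_product_exists\<close>).
\<close>

section \<open>Finite kernels\<close>

text \<open>
  Kernels whose values are finite measures are written as a finite density times a
  subprobability kernel. This form makes the Giry monad applicable and is closed under changing
  the measure over which one disintegrates, since a Radon-Nikodym density becomes part of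
  \<open>\<rho>\<close>.
\<close>

definition finite_kernel :: "'x measure \<Rightarrow> 'y measure \<Rightarrow> ('x \<Rightarrow> 'y measure) \<Rightarrow> bool" where
  "finite_kernel X Y k \<longleftrightarrow>
     (\<exists>\<rho>\<in>borel_measurable X. \<exists>\<kappa>\<in>X \<rightarrow>\<^sub>M subprob_algebra Y.
        (\<forall>x. \<rho> x < \<infinity>) \<and> k = (\<lambda>x. scale_measure (\<rho> x) (\<kappa> x)))"

lemma finite_kernelE:
  assumes "finite_kernel X Y k"
  obtains \<rho> \<kappa> where "\<rho> \<in> borel_measurable X" "\<kappa> \<in> X \<rightarrow>\<^sub>M subprob_algebra Y"
    "\<And>x. \<rho> x < (\<infinity>::ennreal)" "\<And>x. k x = scale_measure (\<rho> x) (\<kappa> x)"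
  using assms unfolding finite_kernel_def by auto

lemma sets_finite_kernel:
  assumes "finite_kernel X Y k" "x \<in> space X"
  shows "sets (k x) = sets Y"
  using assms by (auto simp: finite_kernel_def sets_kernel)

lemma finite_measure_finite_kernel:
  assumes "finite_kernel X Y k" "x \<in> space X"
  shows "finite_measure (k x)"
proof -
  obtain \<rho> \<kappa> where k: "\<kappa> \<in> X \<rightarrow>\<^sub>M subprob_algebra Y"
    "\<And>x. \<rho> x < (\<infinity>::ennreal)" "\<And>x. k x = scale_measure (\<rho> x) (\<kappa> x)"
    using finite_kernelE[OF assms(1)] by metis
  interpret subprob_space "\<kappa> x" by (rule subprob_space_kernel[OF k(1) assms(2)])
  show ?thesis
    using k(2)[of x] by (intro finite_measureI)
      (simp add: k(3) space_scale_measure ennreal_mult_eq_top_iff less_top[symmetric])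
qed

lemma finite_kernel_subprob:
  assumes "k \<in> X \<rightarrow>\<^sub>M subprob_algebra Y"
  shows "finite_kernel X Y k"
  unfolding finite_kernel_def using assms by (intro bexI[of _ "\<lambda>_. 1"] bexI[of _ k]) auto

lemma measurable_nn_integral_finite_kernel:
  assumes k: "finite_kernel X Y k" and f: "f \<in> Z \<rightarrow>\<^sub>M X"
    and h: "(\<lambda>(z, y). h z y) \<in> borel_measurable (Z \<Otimes>\<^sub>M Y)"
  shows "(\<lambda>z. \<integral>\<^sup>+y. h z y \<partial>k (f z)) \<in> borel_measurable Z"
proof -
  obtain \<rho> \<kappa> where *: "\<rho> \<in> borel_measurable X" "\<kappa> \<in> X \<rightarrow>\<^sub>M subprob_algebra Y"
    "\<And>x. k x = scale_measure (\<rho> x) (\<kappa> x)"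
    using finite_kernelE[OF k] by metis
  have c: "(\<lambda>z. \<kappa> (f z)) \<in> Z \<rightarrow>\<^sub>M subprob_algebra Y" using measurable_compose[OF f *(2)] .
  have "(\<lambda>z. \<rho> (f z) * (\<integral>\<^sup>+y. h z y \<partial>\<kappa> (f z))) \<in> borel_measurable Z"
    by (intro borel_measurable_times_ennreal measurable_compose[OF f *(1)]
        nn_integral_measurable_subprob_algebra2[OF h c])
  also have "?this \<longleftrightarrow> ?thesis"
  proof (rule measurable_cong)
    fix z assume z: "z \<in> space Z"
    have "h z \<in> borel_measurable Y"
      using measurable_compose[OF measurable_Pair1'[OF z] h] by simp
    then have "h z \<in> borel_measurable (\<kappa> (f z))"
      using sets_kernel[OF c z] by (simp cong: measurable_cong_sets)
    then show "\<rho> (f z) * (\<integral>\<^sup>+y. h z y \<partial>\<kappa> (f z)) = (\<integral>\<^sup>+y. h z y \<partial>k (f z))"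
      unfolding * by (rule nn_integral_scale_measure[symmetric])
  qed
  finally show ?thesis .
qed

text \<open>
  The image under \<open>g\<close> of the measure that first draws \<open>z\<close> from \<open>\<nu>\<close> and then \<open>y\<close>
  from \<open>k (f z)\<close>. Having it as a measure, and not only as an iterated integral, lets an identity that
  is known on rectangles be extended to all integrands.
\<close>

lemma kernel_image_measure:
  assumes k: "finite_kernel X Y k" and f: "f \<in> Z \<rightarrow>\<^sub>M X"
    and g: "(\<lambda>(z, y). g z y) \<in> Z \<Otimes>\<^sub>M Y \<rightarrow>\<^sub>M W"
    and \<nu>: "sets \<nu> = sets Z"
  obtains \<mu> where "sets \<mu> = sets W"
    "\<And>h. h \<in> borel_measurable W \<Longrightarrow>
       (\<integral>\<^sup>+w. h w \<partial>\<mu>) = (\<integral>\<^sup>+z. \<integral>\<^sup>+y. h (g z y) \<partial>k (f z) \<partial>\<nu>)"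
proof (cases "space Z = {}")
  case True
  then have "space \<nu> = {}" using sets_eq_imp_space_eq[OF \<nu>] by simp
  then show ?thesis
    by (intro that[of "null_measure W"]) (auto simp: nn_integral_empty)
next
  case False
  obtain \<rho> \<kappa> where *: "\<rho> \<in> borel_measurable X" "\<kappa> \<in> X \<rightarrow>\<^sub>M subprob_algebra Y"
    "\<And>x. k x = scale_measure (\<rho> x) (\<kappa> x)"
    using finite_kernelE[OF k] by metis
  have c: "(\<lambda>z. \<kappa> (f z)) \<in> Z \<rightarrow>\<^sub>M subprob_algebra Y" using measurable_compose[OF f *(2)] .
  define K where "K = (\<lambda>z. distr (\<kappa> (f z)) W (g z))"
  have KZ: "K \<in> Z \<rightarrow>\<^sub>M subprob_algebra W"
    unfolding K_def by (rule measurable_distr2[OF _ c]) (use g in simp)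
  define \<nu>' where "\<nu>' = density \<nu> (\<lambda>z. \<rho> (f z))"
  have s\<nu>': "sets \<nu>' = sets Z" and sp: "space \<nu> = space Z" "space \<nu>' = space Z"
    using \<nu> sets_eq_imp_space_eq[OF \<nu>] by (simp_all add: \<nu>'_def)
  have K: "K \<in> \<nu>' \<rightarrow>\<^sub>M subprob_algebra W"
    using KZ by (simp cong: measurable_cong_sets add: s\<nu>')
  have \<rho>f: "(\<lambda>z. \<rho> (f z)) \<in> borel_measurable \<nu>"
    using measurable_compose[OF f *(1)] by (simp cong: measurable_cong_sets add: \<nu>)
  show ?thesis
  proof (rule that[of "\<nu>' \<bind> K"])
    show "sets (\<nu>' \<bind> K) = sets W"
      by (rule sets_bind) (use sets_kernel[OF K] sp False in auto)
    fix h :: "_ \<Rightarrow> ennreal" assume h: "h \<in> borel_measurable W"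
    have "(\<integral>\<^sup>+w. h w \<partial>(\<nu>' \<bind> K)) = (\<integral>\<^sup>+z. \<integral>\<^sup>+w. h w \<partial>K z \<partial>\<nu>')"
      by (rule nn_integral_bind[OF h K])
    also have "\<dots> = (\<integral>\<^sup>+z. \<rho> (f z) * (\<integral>\<^sup>+w. h w \<partial>K z) \<partial>\<nu>)"
      unfolding \<nu>'_def
    proof (rule nn_integral_density[OF \<rho>f])
      show "(\<lambda>z. \<integral>\<^sup>+w. h w \<partial>K z) \<in> borel_measurable \<nu>"
        using measurable_compose[OF KZ nn_integral_measurable_subprob_algebra[OF h]]
        by (simp cong: measurable_cong_sets add: \<nu>)
    qed
    also have "\<dots> = (\<integral>\<^sup>+z. \<integral>\<^sup>+y. h (g z y) \<partial>k (f z) \<partial>\<nu>)"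
    proof (rule nn_integral_cong)
      fix z assume "z \<in> space \<nu>"
      then have z: "z \<in> space Z" by (simp add: sp)
      have s: "sets (\<kappa> (f z)) = sets Y" using sets_kernel[OF c z] .
      have gz: "g z \<in> \<kappa> (f z) \<rightarrow>\<^sub>M W"
        using measurable_compose[OF measurable_Pair1'[OF z] g]
        by (simp cong: measurable_cong_sets add: s)
      show "\<rho> (f z) * (\<integral>\<^sup>+w. h w \<partial>K z) = (\<integral>\<^sup>+y. h (g z y) \<partial>k (f z))"
        unfolding K_def *
        by (simp add: nn_integral_distr[OF gz] h nn_integral_scale_measure
            measurable_compose[OF gz h])
    qed
    finally show "(\<integral>\<^sup>+w. h w \<partial>(\<nu>' \<bind> K)) = (\<integral>\<^sup>+z. \<integral>\<^sup>+y. h (g z y) \<partial>k (f z) \<partial>\<nu>)" .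
  qed
qed

section \<open>Measures on products\<close>

lemma measure_eq_on_rectangles:
  assumes s: "sets \<mu> = sets (X \<Otimes>\<^sub>M Y)" "sets \<nu> = sets (X \<Otimes>\<^sub>M Y)" and "finite_measure \<mu>"
    and eq: "\<And>M N. M \<in> sets X \<Longrightarrow> N \<in> sets Y \<Longrightarrow> emeasure \<mu> (M \<times> N) = emeasure \<nu> (M \<times> N)"
  shows "\<mu> = \<nu>"
proof -
  interpret finite_measure \<mu> by fact
  have "emeasure \<nu> (space X \<times> space Y) \<noteq> \<infinity>"
    using emeasure_finite eq[of "space X" "space Y"] by (metis sets.top infinity_ennreal_def)
  then show ?thesis
    by (intro measure_eqI_generator_eq[where E="{M \<times> N | M N. M \<in> sets X \<and> N \<in> sets Y}"
          and A="\<lambda>_. space X \<times> space Y" and \<Omega>="space X \<times> space Y"])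
      (use s eq pair_measure_closed[of X Y] in
       \<open>auto simp: Int_stable_pair_measure_generator sets_pair_measure\<close>)
qed

lemma emeasure_section:
  assumes [measurable_cong]: "sets \<nu> = sets (X \<Otimes>\<^sub>M Y)" and [measurable]: "N \<in> sets X" "S \<in> sets Y"
  shows "emeasure (distr (density \<nu> (\<lambda>z. indicator N (fst z))) Y snd) S = emeasure \<nu> (N \<times> S)"
    and "emeasure (distr (density \<nu> (\<lambda>z. indicator S (snd z))) X fst) N = emeasure \<nu> (N \<times> S)"
proof -
  have sp: "space \<nu> = space X \<times> space Y"
    using sets_eq_imp_space_eq[OF assms(1)] by (simp add: space_pair_measure)
  have NS: "N \<times> S \<in> sets \<nu>" "N \<times> S \<subseteq> space \<nu>"
    using sets.sets_into_space[OF assms(2)] sets.sets_into_space[OF assms(3)]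
    unfolding assms(1) sp by auto
  have "emeasure (distr (density \<nu> (\<lambda>z. indicator N (fst z))) Y snd) S
      = (\<integral>\<^sup>+z. indicator (N \<times> S) z \<partial>\<nu>)"
    by (subst emeasure_distr, measurable, subst emeasure_density, measurable, intro nn_integral_cong)
      (use NS(2) in \<open>auto simp: indicator_def sp\<close>)
  then show "emeasure (distr (density \<nu> (\<lambda>z. indicator N (fst z))) Y snd) S = emeasure \<nu> (N \<times> S)"
    using NS(1) by simp
  have "emeasure (distr (density \<nu> (\<lambda>z. indicator S (snd z))) X fst) N
      = (\<integral>\<^sup>+z. indicator (N \<times> S) z \<partial>\<nu>)"
    by (subst emeasure_distr, measurable, subst emeasure_density, measurable, intro nn_integral_cong)
      (use NS(2) in \<open>auto simp: indicator_def sp\<close>)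
  then show "emeasure (distr (density \<nu> (\<lambda>z. indicator S (snd z))) X fst) N = emeasure \<nu> (N \<times> S)"
    using NS(1) by simp
qed

lemma measure_eq_on_triple_rectangles:
  assumes s: "sets \<mu> = sets (X \<Otimes>\<^sub>M Y \<Otimes>\<^sub>M Z)" "sets \<nu> = sets (X \<Otimes>\<^sub>M Y \<Otimes>\<^sub>M Z)"
    and fin: "finite_measure \<mu>"
    and eq: "\<And>M N S. M \<in> sets X \<Longrightarrow> N \<in> sets Y \<Longrightarrow> S \<in> sets Z \<Longrightarrow>
       emeasure \<mu> (M \<times> N \<times> S) = emeasure \<nu> (M \<times> N \<times> S)"
  shows "\<mu> = \<nu>"
proof (rule measure_eq_on_rectangles[OF s fin])
  fix M U assume M: "M \<in> sets X" and U: "U \<in> sets (Y \<Otimes>\<^sub>M Z)"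
  let ?R = "\<lambda>\<mu>. distr (density \<mu> (\<lambda>z. indicator M (fst z))) (Y \<Otimes>\<^sub>M Z) snd"
  have "?R \<mu> = ?R \<nu>"
  proof (rule measure_eq_on_rectangles)
    show "finite_measure (?R \<mu>)"
      using emeasure_section(1)[OF s(1) M sets.top] finite_measure.emeasure_finite[OF fin]
      by (intro finite_measureI) simp
    fix N S assume "N \<in> sets Y" "S \<in> sets Z"
    then show "emeasure (?R \<mu>) (N \<times> S) = emeasure (?R \<nu>) (N \<times> S)"
      using M by (simp add: emeasure_section(1)[OF s(1)] emeasure_section(1)[OF s(2)] eq)
  qed auto
  then show "emeasure \<mu> (M \<times> U) = emeasure \<nu> (M \<times> U)"
    using emeasure_section(1)[OF s(1) M U] emeasure_section(1)[OF s(2) M U] by simp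
qed

section \<open>Disintegration\<close>

text \<open>
  Integrating over the set where \<open>g < f\<close> forces this set to be null; finiteness of the integral of
  \<open>g\<close> makes the subtraction legitimate.
\<close>

lemma AE_le_of_set_integral_le:
  fixes f g :: "'a \<Rightarrow> ennreal"
  assumes [measurable]: "f \<in> borel_measurable M" "g \<in> borel_measurable M"
    and le: "\<And>N. N \<in> sets M \<Longrightarrow> (\<integral>\<^sup>+x\<in>N. f x \<partial>M) \<le> (\<integral>\<^sup>+x\<in>N. g x \<partial>M)"
    and fin: "(\<integral>\<^sup>+x. g x \<partial>M) < \<infinity>"
  shows "AE x in M. f x \<le> g x"
proof -
  let ?N = "{x\<in>space M. g x < f x}"
  have fing: "(\<integral>\<^sup>+x\<in>?N. g x \<partial>M) < \<infinity>"
    by (rule le_less_trans[OF nn_integral_mono fin]) (auto simp: indicator_def)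
  have "(\<integral>\<^sup>+x. (f x - g x) * indicator ?N x \<partial>M)
      = (\<integral>\<^sup>+x. f x * indicator ?N x - g x * indicator ?N x \<partial>M)"
    by (intro nn_integral_cong) (auto simp: indicator_def)
  also have "\<dots> = (\<integral>\<^sup>+x\<in>?N. f x \<partial>M) - (\<integral>\<^sup>+x\<in>?N. g x \<partial>M)"
    by (rule nn_integral_diff) (use fing in \<open>auto simp: indicator_def less_top\<close>)
  also have "\<dots> = 0"
    using le[of ?N] le_less_trans[OF le fing] by (intro diff_eq_0_ennreal) auto
  finally have "AE x in M. (f x - g x) * indicator ?N x = 0"
    by (subst (asm) nn_integral_0_iff_AE) auto
  then show ?thesis
    by (rule AE_mp) (auto intro!: AE_I2 simp: indicator_def diff_eq_0_iff_ennreal split: if_splits)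
qed

text \<open>
  Conditional distributions by conditional quantiles. For each rational \<open>q\<close> let \<open>f q x\<close> be
  the conditional probability of \<open>{q..}\<close> given \<open>x\<close>, a Radon-Nikodym derivative. The random variable
  \<open>Z x u\<close>, the supremum of the rationals \<open>q\<close> with \<open>u \<le> f q x\<close>, is taken with respect to a uniformly
  distributed \<open>u\<close>; its law is the value of the kernel at \<open>x\<close>. As an image of a fixed
  probability measure under a jointly measurable map, it is a kernel without any
  exceptional points \<open>x\<close>; almost everywhere monotonicity of the \<open>f q\<close> enters only in the computation
  of its tails \<open>{y<..}\<close>.
\<close>

lemma disintegration_unit_interval:
  fixes \<nu> :: "('x \<times> real) measure"
  assumes s[measurable_cong]: "sets \<nu> = sets (X \<Otimes>\<^sub>M borel)" and fin: "finite_measure \<nu>"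
    and unit: "AE z in \<nu>. 0 \<le> snd z \<and> snd z \<le> 1"
  obtains \<kappa> where "\<kappa> \<in> X \<rightarrow>\<^sub>M subprob_algebra borel"
    "\<And>h. h \<in> borel_measurable (X \<Otimes>\<^sub>M borel) \<Longrightarrow>
       (\<integral>\<^sup>+z. h z \<partial>\<nu>) = (\<integral>\<^sup>+x. \<integral>\<^sup>+y. h (x, y) \<partial>\<kappa> x \<partial>distr \<nu> X fst)"
proof -
  interpret finite_measure \<nu> by fact
  define \<mu> where "\<mu> = distr \<nu> X fst"
  have s\<mu>[measurable_cong, simp]: "sets \<mu> = sets X" and sp\<mu>[simp]: "space \<mu> = space X"
    by (simp_all add: \<mu>_def)
  have sp: "space \<nu> = space X \<times> UNIV"
    using sets_eq_imp_space_eq[OF s] by (simp add: space_pair_measure)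
  interpret \<mu>: finite_measure \<mu> unfolding \<mu>_def by (rule finite_measure_distr) simp
  have \<mu>N: "emeasure \<mu> N = emeasure \<nu> (N \<times> UNIV)" if "N \<in> sets X" for N
    using that sets.sets_into_space[OF that]
    by (auto simp: \<mu>_def emeasure_distr sp intro!: arg_cong[where f="emeasure \<nu>"])
  have NSs[measurable]: "N \<times> S \<in> sets \<nu>" if "N \<in> sets X" "S \<in> sets borel" for N S
    using that by (simp add: s)
  have "\<exists>f\<in>borel_measurable \<mu>. density \<mu> f = distr (density \<nu> (\<lambda>z. indicator {q..} (snd z))) X fst"
    for q :: real
  proof (rule \<mu>.Radon_Nikodym)
    show "absolutely_continuous \<mu> (distr (density \<nu> (\<lambda>z. indicator {q..} (snd z))) X fst)"
      unfolding absolutely_continuous_def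
    proof
      fix N assume N: "N \<in> null_sets \<mu>"
      then have [measurable]: "N \<in> sets X" by auto
      have "emeasure \<nu> (N \<times> {q..}) \<le> emeasure \<nu> (N \<times> UNIV)"
        by (rule emeasure_mono) auto
      also have "\<dots> = 0" using N \<mu>N[of N] by auto
      finally show "N \<in> null_sets (distr (density \<nu> (\<lambda>z. indicator {q..} (snd z))) X fst)"
        by (auto intro!: null_setsI simp: emeasure_section(2)[OF s])
    qed
  qed simp
  then obtain f :: "real \<Rightarrow> 'x \<Rightarrow> ennreal" where "\<And>q. f q \<in> borel_measurable \<mu>"
    and fd: "\<And>q. density \<mu> (f q) = distr (density \<nu> (\<lambda>z. indicator {q..} (snd z))) X fst"
    by metis
  then have f[measurable]: "f q \<in> borel_measurable X" for q
    by (simp cong: measurable_cong_sets)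
  have fI: "(\<integral>\<^sup>+x\<in>N. f q x \<partial>\<mu>) = emeasure \<nu> (N \<times> {q..})" if [measurable]: "N \<in> sets X" for N q
    using arg_cong[OF fd[of q], of "\<lambda>m. emeasure m N"]
    by (simp add: emeasure_section(2)[OF s] emeasure_density)
  \<comment> \<open>Restricting to rationals leaves countably many exceptional null sets.\<close>
  define D :: "real set" where "D = \<rat> \<inter> {0..1}"
  have D: "countable D" "0 \<in> D" "1 \<in> D"
    by (auto simp: D_def countable_rat)
  have fin_f: "(\<integral>\<^sup>+x. f q x \<partial>\<mu>) < \<infinity>" for q
  proof -
    have "(\<integral>\<^sup>+x. f q x \<partial>\<mu>) = (\<integral>\<^sup>+x\<in>space X. f q x \<partial>\<mu>)"
      by (intro nn_integral_cong) simp
    then show ?thesis by (simp add: fI less_top[symmetric])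
  qed
  have AE1: "AE x in \<mu>. \<forall>q\<in>D. f q x \<le> 1"
  proof (subst AE_ball_countable[OF D(1)], intro ballI AE_le_of_set_integral_le)
    fix q N assume N[measurable]: "N \<in> sets \<mu>"
    show "(\<integral>\<^sup>+x\<in>N. f q x \<partial>\<mu>) \<le> (\<integral>\<^sup>+x\<in>N. 1 \<partial>\<mu>)"
      using N by (simp add: fI \<mu>N) (auto intro!: emeasure_mono)
  qed (auto simp: less_top[symmetric] \<mu>.emeasure_eq_measure)
  have AE2: "AE x in \<mu>. \<forall>p\<in>D. \<forall>q\<in>D. p \<le> q \<longrightarrow> f q x \<le> f p x"
  proof (subst AE_ball_countable[OF D(1)], intro ballI,
      subst AE_ball_countable[OF D(1)], intro ballI)
    fix p q show "AE x in \<mu>. p \<le> q \<longrightarrow> f q x \<le> f p x"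
    proof (cases "p \<le> q")
      case True
      have "AE x in \<mu>. f q x \<le> f p x"
      proof (rule AE_le_of_set_integral_le)
        fix N assume N: "N \<in> sets \<mu>"
        then show "(\<integral>\<^sup>+x\<in>N. f q x \<partial>\<mu>) \<le> (\<integral>\<^sup>+x\<in>N. f p x \<partial>\<mu>)"
          using True by (simp add: fI) (auto intro!: emeasure_mono)
      qed (use fin_f[of p] in simp_all)
      then show ?thesis by simp
    qed simp
  qed
  define Z where "Z x u = (SUP q\<in>D. if ennreal u \<le> f q x then q else 0)" for x u
  have bdd: "bdd_above ((\<lambda>q. if ennreal u \<le> f q x then q else 0) ` D)" for x u
    by (rule bdd_aboveI[of _ 1]) (auto simp: D_def)
  have Zm: "(\<lambda>(x, u). Z x u) \<in> borel_measurable (X \<Otimes>\<^sub>M borel)"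
    unfolding Z_def split_beta' using D(1) bdd by measurable
  have Z0: "0 \<le> Z x u" for x u
    unfolding Z_def by (rule cSUP_upper2[OF bdd D(2)]) simp
  have Z1: "Z x u \<le> 1" for x u
    unfolding Z_def by (rule cSUP_least) (use D in \<open>auto simp: D_def\<close>)
  have Zless: "y < Z x u \<longleftrightarrow> (\<exists>q\<in>D. y < q \<and> ennreal u \<le> f q x)" if "0 \<le> y" for x u y
    unfolding Z_def by (subst less_cSUP_iff[OF _ bdd]) (use D that in \<open>auto split: if_splits\<close>)
  define U where "U = uniform_measure lborel {0<..1::real}"
  have sU[measurable_cong, simp]: "sets U = sets borel" by (simp add: U_def)
  have spU[simp]: "space U = UNIV" by (simp add: U_def)
  have Ue: "emeasure U E = emeasure lborel ({0<..1} \<inter> E)" if "E \<in> sets borel" for E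
    unfolding U_def using that by (subst emeasure_uniform_measure) (auto simp: divide_ennreal_def)
  interpret U: prob_space U unfolding U_def by (rule prob_space_uniform_measure) auto
  define \<kappa> where "\<kappa> x = distr U borel (Z x)" for x
  have \<kappa>: "\<kappa> \<in> X \<rightarrow>\<^sub>M subprob_algebra borel"
    unfolding \<kappa>_def
    by (rule measurable_distr2[OF Zm measurable_const])
      (auto simp: space_subprob_algebra U.subprob_space_axioms)
  have \<kappa>y: "emeasure (\<kappa> x) {y<..} = emeasure U {u. y < Z x u}" if "x \<in> space X" for x y
  proof -
    have "Z x \<in> borel_measurable U"
      using measurable_compose[OF measurable_Pair1'[OF that] Zm] by simp
    then show ?thesis by (simp add: \<kappa>_def emeasure_distr vimage_def)
  qed
  \<comment> \<open>Tails determine a finite measure on the reals, so this is the disintegration formula on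
    a generating family of sets.\<close>
  have main: "(\<integral>\<^sup>+x\<in>N. emeasure (\<kappa> x) {y<..} \<partial>\<mu>) = emeasure \<nu> (N \<times> {y<..})"
    if N[measurable]: "N \<in> sets X" for N y
  proof -
    consider "y < 0" | "1 \<le> y" | "0 \<le> y" "y < 1" by linarith
    then show ?thesis
    proof cases
      case 1
      then have "{u. y < Z x u} = space U" for x using Z0[of x] by (auto intro: less_le_trans)
      then have "(\<integral>\<^sup>+x\<in>N. emeasure (\<kappa> x) {y<..} \<partial>\<mu>) = (\<integral>\<^sup>+x. indicator N x \<partial>\<mu>)"
        by (intro nn_integral_cong) (simp add: \<kappa>y U.emeasure_space_1 del: spU)
      also have "\<dots> = emeasure \<nu> (N \<times> UNIV)" by (simp add: \<mu>N)
      also have "\<dots> = emeasure \<nu> (N \<times> {y<..})"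
        by (rule emeasure_eq_AE) (use unit 1 in \<open>auto elim!: eventually_mono\<close>)
      finally show ?thesis .
    next
      case 2
      then have "{u. y < Z x u} = {}" for x using Z1[of x] by (auto simp: not_less intro: order_trans)
      then have "(\<integral>\<^sup>+x\<in>N. emeasure (\<kappa> x) {y<..} \<partial>\<mu>) = (\<integral>\<^sup>+x. 0 \<partial>\<mu>)"
        by (intro nn_integral_cong) (simp add: \<kappa>y)
      also have "\<dots> = emeasure \<nu> {}" by simp
      also have "\<dots> = emeasure \<nu> (N \<times> {y<..})"
      proof (rule emeasure_eq_AE)
        show "AE z in \<nu>. z \<in> {} \<longleftrightarrow> z \<in> N \<times> {y<..}"
          using unit by eventually_elim (use 2 in auto)
      qed auto
      finally show ?thesis .
    next
      case 3
      define E where "E = {q\<in>D. y < q}"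
      have E: "countable E" "E \<noteq> {}" using D 3 by (auto simp: E_def)
      \<comment> \<open>The rationals \<open>r n\<close> decrease to \<open>y\<close>, so the sets \<open>{r n..}\<close> exhaust \<open>{y<..}\<close>.\<close>
      define r where "r n = Min (from_nat_into E ` {..n})" for n
      have rE: "r n \<in> E" for n
      proof -
        have "r n \<in> from_nat_into E ` {..n}" unfolding r_def by (rule Min_in) auto
        then show ?thesis using from_nat_into[OF E(2)] by auto
      qed
      have r_le: "\<exists>n. r n \<le> q" if "q \<in> E" for q
      proof -
        obtain n where "from_nat_into E n = q" using from_nat_into_surj[OF E(1) \<open>q \<in> E\<close>] by auto
        then show ?thesis unfolding r_def by (intro exI[of _ n] Min_le) auto
      qed
      have r_dec: "r m \<le> r n" if "n \<le> m" for m n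
        unfolding r_def by (rule Min_antimono) (use that in auto)
      have "AE x in \<mu>. emeasure (\<kappa> x) {y<..} = (SUP n. f (r n) x)"
        using AE1 AE2 AE_space
      proof eventually_elim
        case (elim x)
        have le1: "f (r n) x \<le> 1" for n using elim(1) rE[of n] by (auto simp: E_def)
        have mono: "f (r n) x \<le> f (r m) x" if "n \<le> m" for m n
          using elim(2) r_dec[OF that] rE[of n] rE[of m] by (auto simp: E_def)
        have fq: "\<exists>n. f q x \<le> f (r n) x" if q: "q \<in> E" for q
        proof -
          obtain n where "r n \<le> q" using r_le[OF q] by blast
          then show ?thesis using elim(2) rE[of n] q by (auto simp: E_def intro!: exI[of _ n])
        qed
        have "emeasure (\<kappa> x) {y<..} = emeasure U {u. y < Z x u}" using elim by (intro \<kappa>y) simp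
        also have "\<dots> = emeasure lborel ({0<..1} \<inter> {u. y < Z x u})"
        proof (rule Ue)
          have "Z x \<in> borel_measurable borel"
            using measurable_compose[OF measurable_Pair1' Zm, of x] elim by simp
          then show "{u. y < Z x u} \<in> sets borel" by measurable
        qed
        also have "{0<..1} \<inter> {u. y < Z x u} = (\<Union>n. {0<..enn2real (f (r n) x)})"
        proof -
          have le: "ennreal u \<le> f (r n) x \<longleftrightarrow> u \<le> enn2real (f (r n) x)" if "0 < u" for u n
            using that le1[of n]
            by (cases "f (r n) x") (auto simp: top_unique)
          have "u \<le> 1" if "u \<le> enn2real (f (r n) x)" for u n
            using that le1[of n] by (cases "f (r n) x") (auto simp: top_unique)
          moreover have "y < Z x u \<longleftrightarrow> (\<exists>n. ennreal u \<le> f (r n) x)" for u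
            unfolding Zless[OF 3(1)] using fq rE by (auto simp: E_def) (meson order_trans)+
          ultimately show ?thesis using le by auto
        qed
        also have "emeasure lborel \<dots> = (SUP n. emeasure lborel {0<..enn2real (f (r n) x)})"
        proof (rule SUP_emeasure_incseq[symmetric])
          have "enn2real (f (r n) x) \<le> enn2real (f (r m) x)" if "n \<le> m" for n m
            using mono[OF that] le1[of m] by (intro enn2real_mono) (auto intro: le_less_trans)
          then show "incseq (\<lambda>n. {0<..enn2real (f (r n) x)})"
            by (auto simp: incseq_def) (meson order_trans)
        qed auto
        also have "\<dots> = (SUP n. f (r n) x)"
        proof (rule SUP_cong[OF refl])
          fix n show "emeasure lborel {0<..enn2real (f (r n) x)} = f (r n) x"
            using le1[of n] by (cases "f (r n) x") (auto simp: top_unique)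
        qed
        finally show ?case .
      qed
      then have "(\<integral>\<^sup>+x\<in>N. emeasure (\<kappa> x) {y<..} \<partial>\<mu>) = (\<integral>\<^sup>+x. (SUP n. f (r n) x * indicator N x) \<partial>\<mu>)"
        by (intro nn_integral_cong_AE) (auto elim!: eventually_mono simp: indicator_def)
      also have "\<dots> = (SUP n. \<integral>\<^sup>+x\<in>N. f (r n) x \<partial>\<mu>)"
      proof (rule nn_integral_monotone_convergence_SUP_AE)
        fix n show "AE x in \<mu>. f (r n) x * indicator N x \<le> f (r (Suc n)) x * indicator N x"
          using AE2 by eventually_elim
            (use rE[of n] rE[of "Suc n"] r_dec[of n "Suc n"] in \<open>auto simp: E_def indicator_def\<close>)
      qed simp
      also have "\<dots> = (SUP n. emeasure \<nu> (N \<times> {r n..}))" by (simp add: fI)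
      also have "\<dots> = emeasure \<nu> (\<Union>n. N \<times> {r n..})"
        by (rule SUP_emeasure_incseq) (use r_dec in \<open>auto simp: incseq_def intro: order_trans\<close>)
      also have "\<dots> = emeasure \<nu> (N \<times> {y<..})"
      proof (rule emeasure_eq_AE)
        have iff: "(\<exists>n. r n \<le> v) \<longleftrightarrow> y < v" if "v \<le> 1" for v
        proof
          assume "\<exists>n. r n \<le> v"
          then show "y < v" using rE by (auto simp: E_def intro: less_le_trans)
        next
          assume "y < v"
          then obtain q where q: "q \<in> \<rat>" "y < q" "q < v" using Rats_dense_in_real by blast
          then have "q \<in> E" using that 3 by (auto simp: E_def D_def)
          from r_le[OF this] q show "\<exists>n. r n \<le> v" by (meson less_imp_le order_trans)
        qed
        show "AE z in \<nu>. z \<in> (\<Union>n. N \<times> {r n..}) \<longleftrightarrow> z \<in> N \<times> {y<..}"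
          using unit
        proof eventually_elim
          case (elim z)
          then show ?case using iff[of "snd z"] by (cases z) auto
        qed
      qed measurable
      finally show ?thesis .
    qed
  qed
  obtain m where m: "sets m = sets (X \<Otimes>\<^sub>M borel)"
    "\<And>h. h \<in> borel_measurable (X \<Otimes>\<^sub>M borel) \<Longrightarrow>
       (\<integral>\<^sup>+w. h w \<partial>m) = (\<integral>\<^sup>+x. \<integral>\<^sup>+y. h (x, y) \<partial>\<kappa> x \<partial>\<mu>)"
    by (rule kernel_image_measure[OF finite_kernel_subprob[OF \<kappa>] measurable_ident_sets[OF refl],
          of Pair "X \<Otimes>\<^sub>M borel" \<mu>]) auto
  have "\<nu> = m"
  proof (rule measure_eq_on_rectangles[OF s m(1) fin])
    fix N S assume N[measurable]: "N \<in> sets X" and S: "S \<in> sets (borel :: real measure)"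
    have "distr (density \<nu> (\<lambda>z. indicator N (fst z))) borel snd
        = distr (density m (\<lambda>z. indicator N (fst z))) borel snd"
    proof (rule measure_eqI_lessThan)
      fix y :: real
      show "emeasure (distr (density \<nu> (\<lambda>z. indicator N (fst z))) borel snd) {y<..} < \<infinity>"
        by (simp add: emeasure_section(1)[OF s] less_top[symmetric])
      have "emeasure m (N \<times> {y<..}) = (\<integral>\<^sup>+w. indicator (N \<times> {y<..}) w \<partial>m)"
        by (simp add: m(1))
      also have "\<dots> = (\<integral>\<^sup>+x. \<integral>\<^sup>+v. indicator (N \<times> {y<..}) (x, v) \<partial>\<kappa> x \<partial>\<mu>)"
        by (rule m(2)) simp
      also have "\<dots> = (\<integral>\<^sup>+x\<in>N. emeasure (\<kappa> x) {y<..} \<partial>\<mu>)"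
        by (intro nn_integral_cong)
          (simp add: \<kappa>_def indicator_times nn_integral_cmult mult.commute)
      finally show "emeasure (distr (density \<nu> (\<lambda>z. indicator N (fst z))) borel snd) {y<..}
          = emeasure (distr (density m (\<lambda>z. indicator N (fst z))) borel snd) {y<..}"
        by (simp add: emeasure_section(1)[OF s] emeasure_section(1)[OF m(1)] main)
    qed auto
    then show "emeasure \<nu> (N \<times> S) = emeasure m (N \<times> S)"
      using emeasure_section(1)[OF s N S] emeasure_section(1)[OF m(1) N S] by simp
  qed
  with m(2) \<kappa> show ?thesis by (intro that[of \<kappa>]) (auto simp: \<mu>_def)
qed

text \<open>
  A target space that is a measurable retract of the unit interval inherits disintegrations: embed
  by \<open>i\<close>, disintegrate, and push the kernel back by \<open>r\<close>.
\<close>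

lemma disintegration_embedded:
  fixes \<nu> :: "('x \<times> 'y) measure"
  assumes s[measurable_cong]: "sets \<nu> = sets (X \<Otimes>\<^sub>M Y)" and fin: "finite_measure \<nu>"
    and i[measurable]: "i \<in> borel_measurable Y" and r[measurable]: "r \<in> borel \<rightarrow>\<^sub>M Y"
    and i01: "\<And>y. y \<in> space Y \<Longrightarrow> 0 \<le> i y \<and> i y \<le> (1::real)"
    and ri: "\<And>y. y \<in> space Y \<Longrightarrow> r (i y) = y"
  obtains \<kappa> where "\<kappa> \<in> X \<rightarrow>\<^sub>M subprob_algebra Y"
    "\<And>h. h \<in> borel_measurable (X \<Otimes>\<^sub>M Y) \<Longrightarrow>
       (\<integral>\<^sup>+z. h z \<partial>\<nu>) = (\<integral>\<^sup>+x. \<integral>\<^sup>+y. h (x, y) \<partial>\<kappa> x \<partial>distr \<nu> X fst)"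
proof -
  have sp: "space \<nu> = space X \<times> space Y"
    using sets_eq_imp_space_eq[OF s] by (simp add: space_pair_measure)
  define \<nu>' where "\<nu>' = distr \<nu> (X \<Otimes>\<^sub>M borel) (\<lambda>(x, y). (x, i y))"
  have "sets \<nu>' = sets (X \<Otimes>\<^sub>M borel)" by (simp add: \<nu>'_def)
  moreover have "finite_measure \<nu>'"
    unfolding \<nu>'_def by (rule finite_measure.finite_measure_distr[OF fin]) measurable
  moreover have "AE z in \<nu>'. 0 \<le> snd z \<and> snd z \<le> 1"
    unfolding \<nu>'_def by (subst AE_distr_iff) (auto intro!: AE_I2 simp: i01 sp)
  ultimately obtain \<kappa> where \<kappa>: "\<kappa> \<in> X \<rightarrow>\<^sub>M subprob_algebra borel"
    "\<And>h. h \<in> borel_measurable (X \<Otimes>\<^sub>M borel) \<Longrightarrow>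
       (\<integral>\<^sup>+z. h z \<partial>\<nu>') = (\<integral>\<^sup>+x. \<integral>\<^sup>+y. h (x, y) \<partial>\<kappa> x \<partial>distr \<nu>' X fst)"
    using disintegration_unit_interval by blast
  have marg: "distr \<nu>' X fst = distr \<nu> X fst"
    unfolding \<nu>'_def by (subst distr_distr) (auto simp: comp_def split_beta')
  show ?thesis
  proof (rule that[of "\<lambda>x. distr (\<kappa> x) Y r"])
    show "(\<lambda>x. distr (\<kappa> x) Y r) \<in> X \<rightarrow>\<^sub>M subprob_algebra Y"
      by (rule measurable_compose[OF \<kappa>(1) measurable_distr[OF r]])
    fix h :: "'x \<times> 'y \<Rightarrow> ennreal" assume h[measurable]: "h \<in> borel_measurable (X \<Otimes>\<^sub>M Y)"
    have "(\<integral>\<^sup>+z. h z \<partial>\<nu>) = (\<integral>\<^sup>+z. h (fst z, r (i (snd z))) \<partial>\<nu>)"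
      by (intro nn_integral_cong) (auto simp: sp ri)
    also have "\<dots> = (\<integral>\<^sup>+z. h (fst z, r (snd z)) \<partial>\<nu>')"
      unfolding \<nu>'_def by (subst nn_integral_distr) (auto simp: split_beta')
    also have "\<dots> = (\<integral>\<^sup>+x. \<integral>\<^sup>+y. h (x, r y) \<partial>\<kappa> x \<partial>distr \<nu> X fst)"
      by (subst \<kappa>(2)) (auto simp: marg)
    also have "\<dots> = (\<integral>\<^sup>+x. \<integral>\<^sup>+y. h (x, y) \<partial>distr (\<kappa> x) Y r \<partial>distr \<nu> X fst)"
    proof (rule nn_integral_cong)
      fix x assume "x \<in> space (distr \<nu> X fst)"
      then have x: "x \<in> space X" by simp
      have [measurable_cong]: "sets (\<kappa> x) = sets borel" by (rule sets_kernel[OF \<kappa>(1) x])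
      have [measurable]: "(\<lambda>y. h (x, y)) \<in> borel_measurable Y"
        using measurable_compose[OF measurable_Pair1'[OF x] h] .
      show "(\<integral>\<^sup>+y. h (x, r y) \<partial>\<kappa> x) = (\<integral>\<^sup>+y. h (x, y) \<partial>distr (\<kappa> x) Y r)"
        by (subst nn_integral_distr) auto
    qed
    finally show "(\<integral>\<^sup>+z. h z \<partial>\<nu>) = (\<integral>\<^sup>+x. \<integral>\<^sup>+y. h (x, y) \<partial>distr (\<kappa> x) Y r \<partial>distr \<nu> X fst)" .
  qed
qed

lemma space_pos_reals [simp]: "space pos_reals = {0<..}"
  by (simp add: space_restrict_space)

lemma measurable_pos_realsI:
  assumes "f \<in> borel_measurable M" "\<And>x. x \<in> space M \<Longrightarrow> 0 < f x"
  shows "f \<in> M \<rightarrow>\<^sub>M pos_reals"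
  using assms by (intro measurable_restrict_space2) auto

lemma measurable_from_pos_reals:
  "f \<in> borel \<rightarrow>\<^sub>M M \<Longrightarrow> f \<in> pos_reals \<rightarrow>\<^sub>M M"
  by (rule measurable_restrict_space1)

lemma disintegration_pos_reals:
  fixes \<nu> :: "('x \<times> real) measure"
  assumes "sets \<nu> = sets (X \<Otimes>\<^sub>M pos_reals)" and "finite_measure \<nu>"
  obtains \<kappa> where "\<kappa> \<in> X \<rightarrow>\<^sub>M subprob_algebra pos_reals"
    "\<And>h. h \<in> borel_measurable (X \<Otimes>\<^sub>M pos_reals) \<Longrightarrow>
       (\<integral>\<^sup>+z. h z \<partial>\<nu>) = (\<integral>\<^sup>+x. \<integral>\<^sup>+y. h (x, y) \<partial>\<kappa> x \<partial>distr \<nu> X fst)"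
proof -
  have i: "(\<lambda>t. t / (1 + t)) \<in> borel_measurable pos_reals"
    by (rule measurable_from_pos_reals) measurable
  have r: "(\<lambda>u. if 0 < u \<and> u < 1 then u / (1 - u) else 1) \<in> borel \<rightarrow>\<^sub>M pos_reals"
    by (rule measurable_pos_realsI) auto
  have i01: "0 \<le> t / (1 + t) \<and> t / (1 + t) \<le> 1" if "t \<in> space pos_reals" for t :: real
    using that by simp
  have ri: "(if 0 < t / (1 + t) \<and> t / (1 + t) < 1 then t / (1 + t) / (1 - t / (1 + t)) else 1) = t"
    if "t \<in> space pos_reals" for t :: real
    using that by (simp add: field_simps)
  show ?thesis
    by (rule disintegration_embedded[OF assms i r i01 ri that])
qed

lemma disintegration_real:
  fixes \<nu> :: "('x \<times> real) measure"
  assumes "sets \<nu> = sets (X \<Otimes>\<^sub>M borel)" and "finite_measure \<nu>"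
  obtains \<kappa> where "\<kappa> \<in> X \<rightarrow>\<^sub>M subprob_algebra borel"
    "\<And>h. h \<in> borel_measurable (X \<Otimes>\<^sub>M borel) \<Longrightarrow>
       (\<integral>\<^sup>+z. h z \<partial>\<nu>) = (\<integral>\<^sup>+x. \<integral>\<^sup>+y. h (x, y) \<partial>\<kappa> x \<partial>distr \<nu> X fst)"
proof -
  have i: "(\<lambda>t. exp t / (1 + exp t)) \<in> borel_measurable (borel :: real measure)"
    by measurable
  have r: "(\<lambda>u. ln (u / (1 - u))) \<in> borel \<rightarrow>\<^sub>M (borel :: real measure)"
    by measurable
  have i01: "0 \<le> exp t / (1 + exp t) \<and> exp t / (1 + exp t) \<le> 1" for t :: real
    using add_pos_pos[OF zero_less_one exp_gt_zero, of t] by (simp add: divide_le_eq)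
  have "exp t / (1 + exp t) / (1 - exp t / (1 + exp t)) = exp t" for t :: real
    using add_pos_pos[OF zero_less_one exp_gt_zero, of t] by (simp add: field_simps)
  then have ri: "ln (exp t / (1 + exp t) / (1 - exp t / (1 + exp t))) = t" for t :: real
    by simp
  show ?thesis
    by (rule disintegration_embedded[OF assms i r i01 ri that])
qed

text \<open>
  The last coordinate is disintegrated over the first two, then the middle one over the first, and the two
  kernels are composed in the Giry monad.
\<close>

lemma disintegration_real_pos_reals:
  fixes \<nu> :: "('x \<times> real \<times> real) measure"
  assumes s[measurable_cong]: "sets \<nu> = sets (X \<Otimes>\<^sub>M borel \<Otimes>\<^sub>M pos_reals)" and fin: "finite_measure \<nu>"
  obtains \<kappa> where "\<kappa> \<in> X \<rightarrow>\<^sub>M subprob_algebra (borel \<Otimes>\<^sub>M pos_reals)"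
    "\<And>h. h \<in> borel_measurable (X \<Otimes>\<^sub>M borel \<Otimes>\<^sub>M pos_reals) \<Longrightarrow>
       (\<integral>\<^sup>+z. h z \<partial>\<nu>) = (\<integral>\<^sup>+x. \<integral>\<^sup>+y. h (x, y) \<partial>\<kappa> x \<partial>distr \<nu> X fst)"
proof -
  define \<nu>' where "\<nu>' = distr \<nu> ((X \<Otimes>\<^sub>M borel) \<Otimes>\<^sub>M pos_reals) (\<lambda>(x, y, t). ((x, y), t))"
  have "sets \<nu>' = sets ((X \<Otimes>\<^sub>M borel) \<Otimes>\<^sub>M pos_reals)" by (simp add: \<nu>'_def)
  moreover have "finite_measure \<nu>'"
    unfolding \<nu>'_def by (rule finite_measure.finite_measure_distr[OF fin]) measurable
  ultimately obtain l where l[measurable]: "l \<in> X \<Otimes>\<^sub>M borel \<rightarrow>\<^sub>M subprob_algebra pos_reals"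
    and lI: "\<And>h. h \<in> borel_measurable ((X \<Otimes>\<^sub>M borel) \<Otimes>\<^sub>M pos_reals) \<Longrightarrow>
       (\<integral>\<^sup>+z. h z \<partial>\<nu>') = (\<integral>\<^sup>+x. \<integral>\<^sup>+y. h (x, y) \<partial>l x \<partial>distr \<nu>' (X \<Otimes>\<^sub>M borel) fst)"
    using disintegration_pos_reals by blast
  define \<nu>'' where "\<nu>'' = distr \<nu>' (X \<Otimes>\<^sub>M borel) fst"
  have [measurable_cong]: "sets \<nu>' = sets ((X \<Otimes>\<^sub>M borel) \<Otimes>\<^sub>M pos_reals)" by fact
  have "sets \<nu>'' = sets (X \<Otimes>\<^sub>M borel)" by (simp add: \<nu>''_def)
  moreover have "finite_measure \<nu>''"
    unfolding \<nu>''_def by (rule finite_measure.finite_measure_distr[OF \<open>finite_measure \<nu>'\<close>]) measurable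
  ultimately obtain k where k[measurable]: "k \<in> X \<rightarrow>\<^sub>M subprob_algebra borel"
    and kI: "\<And>h. h \<in> borel_measurable (X \<Otimes>\<^sub>M borel) \<Longrightarrow>
       (\<integral>\<^sup>+z. h z \<partial>\<nu>'') = (\<integral>\<^sup>+x. \<integral>\<^sup>+y. h (x, y) \<partial>k x \<partial>distr \<nu>'' X fst)"
    using disintegration_real by blast
  have marg: "distr \<nu>'' X fst = distr \<nu> X fst"
    unfolding \<nu>'_def \<nu>''_def by (simp add: distr_distr comp_def split_beta')
  define \<kappa> where "\<kappa> x = k x \<bind> (\<lambda>y. distr (l (x, y)) (borel \<Otimes>\<^sub>M pos_reals) (Pair y))" for x
  have in1: "(\<lambda>p. distr (l p) (borel \<Otimes>\<^sub>M pos_reals) (Pair (snd p)))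
      \<in> X \<Otimes>\<^sub>M borel \<rightarrow>\<^sub>M subprob_algebra (borel \<Otimes>\<^sub>M pos_reals)"
    by (rule measurable_distr2[OF _ l]) measurable
  have \<kappa>: "\<kappa> \<in> X \<rightarrow>\<^sub>M subprob_algebra (borel \<Otimes>\<^sub>M pos_reals)"
    unfolding \<kappa>_def by (rule measurable_bind[OF k]) (use in1 in simp)
  show ?thesis
  proof (rule that[OF \<kappa>])
    fix h :: "'x \<times> real \<times> real \<Rightarrow> ennreal"
    assume h[measurable]: "h \<in> borel_measurable (X \<Otimes>\<^sub>M borel \<Otimes>\<^sub>M pos_reals)"
    have m: "(\<lambda>p. \<integral>\<^sup>+t. h (fst p, snd p, t) \<partial>l p) \<in> borel_measurable (X \<Otimes>\<^sub>M borel)"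
      by (rule nn_integral_measurable_subprob_algebra2[OF _ l]) measurable
    have "(\<integral>\<^sup>+z. h z \<partial>\<nu>) = (\<integral>\<^sup>+z. h (fst (fst z), snd (fst z), snd z) \<partial>\<nu>')"
      unfolding \<nu>'_def by (subst nn_integral_distr) (auto simp: split_beta')
    also have "\<dots> = (\<integral>\<^sup>+p. \<integral>\<^sup>+t. h (fst p, snd p, t) \<partial>l p \<partial>\<nu>'')"
      unfolding \<nu>''_def by (subst lI) auto
    also have "\<dots> = (\<integral>\<^sup>+x. \<integral>\<^sup>+y. \<integral>\<^sup>+t. h (x, y, t) \<partial>l (x, y) \<partial>k x \<partial>distr \<nu> X fst)"
      by (subst kI[OF m]) (simp add: marg)
    also have "\<dots> = (\<integral>\<^sup>+x. \<integral>\<^sup>+y. h (x, y) \<partial>\<kappa> x \<partial>distr \<nu> X fst)"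
    proof (rule nn_integral_cong)
      fix x assume "x \<in> space (distr \<nu> X fst)"
      then have x: "x \<in> space X" by simp
      have hx[measurable]: "(\<lambda>y. h (x, y)) \<in> borel_measurable (borel \<Otimes>\<^sub>M pos_reals)"
        using measurable_compose[OF measurable_Pair1'[OF x] h] .
      have sk[measurable_cong]: "sets (k x) = sets borel" by (rule sets_kernel[OF k x])
      have in2: "(\<lambda>y. distr (l (x, y)) (borel \<Otimes>\<^sub>M pos_reals) (Pair y))
          \<in> k x \<rightarrow>\<^sub>M subprob_algebra (borel \<Otimes>\<^sub>M pos_reals)"
        using measurable_compose[OF measurable_Pair1'[OF x] in1] by (simp cong: measurable_cong_sets add: sk)
      have "(\<integral>\<^sup>+y. h (x, y) \<partial>\<kappa> x)
          = (\<integral>\<^sup>+y. \<integral>\<^sup>+w. h (x, w) \<partial>distr (l (x, y)) (borel \<Otimes>\<^sub>M pos_reals) (Pair y) \<partial>k x)"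
        unfolding \<kappa>_def by (rule nn_integral_bind[OF hx in2])
      also have "\<dots> = (\<integral>\<^sup>+y. \<integral>\<^sup>+t. h (x, y, t) \<partial>l (x, y) \<partial>k x)"
      proof (rule nn_integral_cong)
        fix y :: real
        have sl: "sets (l (x, y)) = sets pos_reals"
          by (rule sets_kernel[OF l]) (simp add: space_pair_measure x)
        show "(\<integral>\<^sup>+w. h (x, w) \<partial>distr (l (x, y)) (borel \<Otimes>\<^sub>M pos_reals) (Pair y))
            = (\<integral>\<^sup>+t. h (x, y, t) \<partial>l (x, y))"
          by (subst nn_integral_distr)
            (auto simp: measurable_cong_sets[OF sl refl] intro!: measurable_Pair1')
      qed
      finally show "(\<integral>\<^sup>+y. \<integral>\<^sup>+t. h (x, y, t) \<partial>l (x, y) \<partial>k x) = (\<integral>\<^sup>+y. h (x, y) \<partial>\<kappa> x)" by simp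
    qed
    finally show "(\<integral>\<^sup>+z. h z \<partial>\<nu>) = (\<integral>\<^sup>+x. \<integral>\<^sup>+y. h (x, y) \<partial>\<kappa> x \<partial>distr \<nu> X fst)" .
  qed
qed

section \<open>Fibre measures over a base\<close>

text \<open>
  Passing from the base \<open>\<mu>\<close> to the base \<open>B\<close> multiplies the kernel by the Radon-Nikodym derivative,
  which is modified on a null set so as to be finite everywhere.
\<close>

lemma rebase_kernel:
  assumes "sigma_finite_measure B" and \<kappa>: "\<kappa> \<in> B \<rightarrow>\<^sub>M subprob_algebra Y"
    and "finite_measure \<mu>" and ac: "absolutely_continuous B \<mu>" and s: "sets \<mu> = sets B"
  obtains k where "finite_kernel B Y k"
    "\<And>h. h \<in> borel_measurable (B \<Otimes>\<^sub>M Y) \<Longrightarrow>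
       (\<integral>\<^sup>+x. \<integral>\<^sup>+y. h (x, y) \<partial>\<kappa> x \<partial>\<mu>) = (\<integral>\<^sup>+x. \<integral>\<^sup>+y. h (x, y) \<partial>k x \<partial>B)"
proof -
  interpret B: sigma_finite_measure B by fact
  interpret \<mu>: finite_measure \<mu> by fact
  obtain f where f[measurable]: "f \<in> borel_measurable B" and d: "density B f = \<mu>"
    using B.Radon_Nikodym[OF ac s] by blast
  have "(\<integral>\<^sup>+x. f x \<partial>B) = emeasure \<mu> (space B)"
    by (auto simp: d[symmetric] emeasure_density intro!: nn_integral_cong)
  then have "AE x in B. f x \<noteq> \<infinity>"
    by (intro nn_integral_PInf_AE) auto
  define \<rho> where "\<rho> x = (if f x = \<infinity> then 0 else f x)" for x
  have \<rho>[measurable]: "\<rho> \<in> borel_measurable B" unfolding \<rho>_def by measurable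
  have f\<rho>: "AE x in B. f x = \<rho> x" using \<open>AE x in B. f x \<noteq> \<infinity>\<close> by (auto simp: \<rho>_def)
  show ?thesis
  proof (rule that[of "\<lambda>x. scale_measure (\<rho> x) (\<kappa> x)"])
    show "finite_kernel B Y (\<lambda>x. scale_measure (\<rho> x) (\<kappa> x))"
      unfolding finite_kernel_def using \<kappa> \<rho>
      by (intro bexI[of _ \<rho>] bexI[of _ \<kappa>]) (auto simp: \<rho>_def less_top)
    fix h :: "_ \<Rightarrow> ennreal" assume h: "h \<in> borel_measurable (B \<Otimes>\<^sub>M Y)"
    have [measurable]: "(\<lambda>x. \<integral>\<^sup>+y. h (x, y) \<partial>\<kappa> x) \<in> borel_measurable B"
      by (rule nn_integral_measurable_subprob_algebra2[OF _ \<kappa>]) (simp add: h)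
    have "(\<integral>\<^sup>+x. \<integral>\<^sup>+y. h (x, y) \<partial>\<kappa> x \<partial>\<mu>) = (\<integral>\<^sup>+x. f x * (\<integral>\<^sup>+y. h (x, y) \<partial>\<kappa> x) \<partial>B)"
      unfolding d[symmetric] by (rule nn_integral_density) measurable
    also have "\<dots> = (\<integral>\<^sup>+x. \<rho> x * (\<integral>\<^sup>+y. h (x, y) \<partial>\<kappa> x) \<partial>B)"
      by (rule nn_integral_cong_AE) (use f\<rho> in \<open>auto elim!: eventually_mono\<close>)
    also have "\<dots> = (\<integral>\<^sup>+x. \<integral>\<^sup>+y. h (x, y) \<partial>scale_measure (\<rho> x) (\<kappa> x) \<partial>B)"
    proof (rule nn_integral_cong)
      fix x assume x: "x \<in> space B"
      have "(\<lambda>y. h (x, y)) \<in> borel_measurable (\<kappa> x)"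
        using measurable_compose[OF measurable_Pair1'[OF x] h]
        by (simp cong: measurable_cong_sets add: sets_kernel[OF \<kappa> x])
      then show "\<rho> x * (\<integral>\<^sup>+y. h (x, y) \<partial>\<kappa> x) = (\<integral>\<^sup>+y. h (x, y) \<partial>scale_measure (\<rho> x) (\<kappa> x))"
        by (rule nn_integral_scale_measure[symmetric])
    qed
    finally show "(\<integral>\<^sup>+x. \<integral>\<^sup>+y. h (x, y) \<partial>\<kappa> x \<partial>\<mu>)
        = (\<integral>\<^sup>+x. \<integral>\<^sup>+y. h (x, y) \<partial>scale_measure (\<rho> x) (\<kappa> x) \<partial>B)" .
  qed
qed

text \<open>
  The part of \<open>\<nu>\<close> on \<open>E\<close>, carried to \<open>B \<times> (0,\<infinity>)\<close> by \<open>\<pi>\<close>, has the fibres \<open>k b\<close> over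
  \<open>B\<close>. Both families \<open>p_M\<close> and \<open>q_K\<close> that occur in the product of polymorphisms are
  instances. The condition is put on integrals of functions of both variables, because this is how the
  fibres are used.
\<close>

definition fibre_family ::
  "'b measure \<Rightarrow> 'z measure \<Rightarrow> 'z set \<Rightarrow> ('z \<Rightarrow> 'b \<times> real) \<Rightarrow> ('b \<Rightarrow> real measure) \<Rightarrow> bool" where
  "fibre_family B \<nu> E \<pi> k \<longleftrightarrow> finite_kernel B pos_reals k \<and>
     (\<forall>h\<in>borel_measurable (B \<Otimes>\<^sub>M pos_reals).
        (\<integral>\<^sup>+z\<in>E. h (\<pi> z) \<partial>\<nu>) = (\<integral>\<^sup>+b. \<integral>\<^sup>+s. h (b, s) \<partial>k b \<partial>B))"

lemma fibre_family_kernel: "fibre_family B \<nu> E \<pi> k \<Longrightarrow> finite_kernel B pos_reals k"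
  by (simp add: fibre_family_def)

lemma nn_integral_fibre_family:
  assumes "fibre_family B \<nu> E \<pi> k" "(\<lambda>(b, s). h b s) \<in> borel_measurable (B \<Otimes>\<^sub>M pos_reals)"
  shows "(\<integral>\<^sup>+z\<in>E. h (fst (\<pi> z)) (snd (\<pi> z)) \<partial>\<nu>) = (\<integral>\<^sup>+b. \<integral>\<^sup>+s. h b s \<partial>k b \<partial>B)"
  using assms unfolding fibre_family_def by (auto simp: split_beta' dest!: bspec)

lemma fibre_family_exists:
  assumes "sigma_finite_measure B" and fin: "finite_measure \<nu>" and E[measurable]: "E \<in> sets \<nu>"
    and \<pi>[measurable]: "\<pi> \<in> \<nu> \<rightarrow>\<^sub>M B \<Otimes>\<^sub>M pos_reals"
    and null: "\<And>N. N \<in> null_sets B \<Longrightarrow> AE z in \<nu>. fst (\<pi> z) \<notin> N"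
  obtains k where "fibre_family B \<nu> E \<pi> k"
proof -
  interpret finite_measure \<nu> by fact
  define \<nu>' where "\<nu>' = distr (density \<nu> (indicator E)) (B \<Otimes>\<^sub>M pos_reals) \<pi>"
  have s: "sets \<nu>' = sets (B \<Otimes>\<^sub>M pos_reals)" by (simp add: \<nu>'_def)
  have "emeasure (density \<nu> (indicator E)) (space \<nu>) < \<infinity>"
    by (simp add: emeasure_density less_top[symmetric])
  then have "finite_measure (density \<nu> (indicator E))" by (intro finite_measureI) auto
  then have fin': "finite_measure \<nu>'"
    unfolding \<nu>'_def by (rule finite_measure.finite_measure_distr) measurable
  obtain \<kappa> where \<kappa>: "\<kappa> \<in> B \<rightarrow>\<^sub>M subprob_algebra pos_reals"
    and \<kappa>I: "\<And>h. h \<in> borel_measurable (B \<Otimes>\<^sub>M pos_reals) \<Longrightarrow>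
       (\<integral>\<^sup>+z. h z \<partial>\<nu>') = (\<integral>\<^sup>+x. \<integral>\<^sup>+y. h (x, y) \<partial>\<kappa> x \<partial>distr \<nu>' B fst)"
    using disintegration_pos_reals[OF s fin'] by blast
  have ds: "distr \<nu>' B fst = distr (density \<nu> (indicator E)) B (\<lambda>z. fst (\<pi> z))"
    unfolding \<nu>'_def by (subst distr_distr) (auto simp: comp_def)
  have "absolutely_continuous B (distr \<nu>' B fst)"
    unfolding absolutely_continuous_def
  proof
    fix N assume N: "N \<in> null_sets B"
    then have [measurable]: "N \<in> sets B" by auto
    have "emeasure (distr \<nu>' B fst) N = (\<integral>\<^sup>+z. indicator E z * indicator N (fst (\<pi> z)) \<partial>\<nu>)"
      unfolding ds by (subst emeasure_distr, measurable, subst emeasure_density, measurable,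
          intro nn_integral_cong) (auto simp: indicator_def)
    also have "\<dots> = (\<integral>\<^sup>+z. 0 \<partial>\<nu>)"
      by (rule nn_integral_cong_AE) (use null[OF N] in \<open>auto elim!: eventually_mono\<close>)
    finally show "N \<in> null_sets (distr \<nu>' B fst)" by (auto intro!: null_setsI)
  qed
  moreover have "finite_measure (distr \<nu>' B fst)"
    by (rule finite_measure.finite_measure_distr[OF fin']) (simp cong: measurable_cong_sets add: s)
  ultimately obtain k where k: "finite_kernel B pos_reals k"
    "\<And>h. h \<in> borel_measurable (B \<Otimes>\<^sub>M pos_reals) \<Longrightarrow>
       (\<integral>\<^sup>+x. \<integral>\<^sup>+y. h (x, y) \<partial>\<kappa> x \<partial>distr \<nu>' B fst) = (\<integral>\<^sup>+x. \<integral>\<^sup>+y. h (x, y) \<partial>k x \<partial>B)"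
    using rebase_kernel[OF assms(1) \<kappa>, of "distr \<nu>' B fst"] by auto
  show ?thesis
  proof (rule that, unfold fibre_family_def, intro conjI ballI)
    show "finite_kernel B pos_reals k" by (rule k(1))
    fix h :: "_ \<Rightarrow> ennreal" assume h[measurable]: "h \<in> borel_measurable (B \<Otimes>\<^sub>M pos_reals)"
    have "(\<integral>\<^sup>+z\<in>E. h (\<pi> z) \<partial>\<nu>) = (\<integral>\<^sup>+z. h z \<partial>\<nu>')"
      unfolding \<nu>'_def by (subst nn_integral_distr, measurable, subst nn_integral_density)
        (auto simp: mult.commute)
    then show "(\<integral>\<^sup>+z\<in>E. h (\<pi> z) \<partial>\<nu>) = (\<integral>\<^sup>+b. \<integral>\<^sup>+s. h (b, s) \<partial>k b \<partial>B)"
      by (simp add: \<kappa>I k(2))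
  qed
qed

lemma ennreal_measurable_pos_reals [measurable (raw)]:
  assumes "f \<in> M \<rightarrow>\<^sub>M pos_reals"
  shows "(\<lambda>x. ennreal (f x)) \<in> borel_measurable M"
  by (rule measurable_compose[OF assms]) (rule measurable_from_pos_reals, measurable)

lemma times_measurable_pos_reals [measurable (raw)]:
  assumes f: "f \<in> M \<rightarrow>\<^sub>M pos_reals" and g: "g \<in> M \<rightarrow>\<^sub>M pos_reals"
  shows "(\<lambda>x. f x * g x) \<in> M \<rightarrow>\<^sub>M pos_reals"
proof (rule measurable_pos_realsI)
  have id: "(\<lambda>x. x) \<in> pos_reals \<rightarrow>\<^sub>M borel" by (rule measurable_from_pos_reals) simp
  show "(\<lambda>x. f x * g x) \<in> borel_measurable M"
    using measurable_compose[OF f id] measurable_compose[OF g id] by (rule borel_measurable_times)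
  show "0 < f x * g x" if "x \<in> space M" for x
    using measurable_space[OF f that] measurable_space[OF g that] by simp
qed

lemma measure_family_fibre_family:
  assumes k: "fibre_family B \<nu> E \<pi> k" and E[measurable]: "E \<in> sets \<nu>"
    and \<pi>[measurable]: "\<pi> \<in> \<nu> \<rightarrow>\<^sub>M B \<Otimes>\<^sub>M pos_reals"
    and fin: "(\<integral>\<^sup>+z\<in>E. ennreal (snd (\<pi> z)) \<partial>\<nu>) < \<infinity>"
    and m: "\<And>N S. N \<in> sets B \<Longrightarrow> S \<in> sets pos_reals \<Longrightarrow>
       emeasure (m N) S = (\<integral>\<^sup>+z\<in>E. indicator N (fst (\<pi> z)) * indicator S (snd (\<pi> z)) \<partial>\<nu>)"
  shows "measure_family B m k"
  unfolding measure_family_def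
proof (intro conjI ballI)
  note kk = fibre_family_kernel[OF k]
  have "(\<integral>\<^sup>+b. \<integral>\<^sup>+s. ennreal s \<partial>k b \<partial>B) < \<infinity>"
    using nn_integral_fibre_family[OF k, of "\<lambda>b s. ennreal s"] fin by simp
  moreover have "(\<lambda>b. \<integral>\<^sup>+s. ennreal s \<partial>k b) \<in> borel_measurable B"
    by (rule measurable_nn_integral_finite_kernel[OF kk measurable_ident_sets[OF refl]]) measurable
  ultimately have "AE b in B. (\<integral>\<^sup>+s. ennreal s \<partial>k b) \<noteq> \<infinity>"
    by (intro nn_integral_PInf_AE) auto
  then show "AE b in B. k b \<in> M_tri"
    using AE_space
  proof eventually_elim
    case (elim b)
    then interpret finite_measure "k b" using finite_measure_finite_kernel[OF kk] by simp
    show ?case using elim by (auto simp: M_tri_def sets_finite_kernel[OF kk] less_top[symmetric])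
  qed
next
  fix S assume S[measurable]: "S \<in> sets pos_reals"
  note kk = fibre_family_kernel[OF k]
  have eS: "(\<integral>\<^sup>+s. indicator S s \<partial>k b) = emeasure (k b) S" if "b \<in> space B" for b
    using that by (simp add: sets_finite_kernel[OF kk])
  have "(\<lambda>b. \<integral>\<^sup>+s. indicator S s \<partial>k b) \<in> borel_measurable B"
    by (rule measurable_nn_integral_finite_kernel[OF kk measurable_ident_sets[OF refl]]) measurable
  then show "(\<lambda>b. emeasure (k b) S) \<in> borel_measurable B"
    by (simp cong: measurable_cong add: eS)
  fix N assume N[measurable]: "N \<in> sets B"
  have "emeasure (m N) S = (\<integral>\<^sup>+b. \<integral>\<^sup>+s. indicator N b * indicator S s \<partial>k b \<partial>B)"
    unfolding m[OF N S] by (rule nn_integral_fibre_family[OF k]) measurable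
  also have "\<dots> = (\<integral>\<^sup>+b\<in>N. emeasure (k b) S \<partial>B)"
  proof (rule nn_integral_cong)
    fix b assume b: "b \<in> space B"
    then show "(\<integral>\<^sup>+s. indicator N b * indicator S s \<partial>k b) = emeasure (k b) S * indicator N b"
      by (subst nn_integral_cmult)
        (simp_all add: measurable_cong_sets[OF sets_finite_kernel[OF kk b] refl] eS mult.commute)
  qed
  finally show "emeasure (m N) S = (\<integral>\<^sup>+b\<in>N. emeasure (k b) S \<partial>B)" .
qed

lemma measure_eqI_rat_pos_reals:
  assumes s: "sets \<mu> = sets pos_reals" "sets \<nu> = sets pos_reals" and "finite_measure \<mu>"
    and eq: "\<And>q. q \<in> \<rat> \<Longrightarrow> emeasure \<mu> ({q<..} \<inter> {0<..}) = emeasure \<nu> ({q<..} \<inter> {0<..})"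
  shows "\<mu> = \<nu>"
proof (rule measure_eqI_generator_eq[where E="(\<lambda>q. {q<..} \<inter> {0<..}) ` \<rat>" and \<Omega>="{0<..}"
      and A="\<lambda>_. {0<..}"])
  interpret finite_measure \<mu> by fact
  let ?E = "(\<lambda>q::real. {q<..} \<inter> {0<..}) ` \<rat>"
  have eqs: "sets pos_reals = sigma_sets {0<..} ?E"
  proof
    have "(\<lambda>q. q) \<in> borel_measurable (sigma {0<..} ?E)"
    proof (rule borel_measurableI_greater)
      fix y :: real
      have "{x \<in> space (sigma {0<..} ?E). y < x} = (\<Union>q\<in>{q\<in>\<rat>. y < q}. {q<..} \<inter> {0<..})"
        by (auto simp: space_measure_of_conv dest: Rats_dense_in_real intro: less_trans)
      also have "\<dots> \<in> sets (sigma {0<..} ?E)"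
        by (rule sets.countable_UN') (auto simp: countable_rat intro: sigma_sets.Basic)
      finally show "{x \<in> space (sigma {0<..} ?E). y < x} \<in> sets (sigma {0<..} ?E)" .
    qed
    then have "(\<lambda>q. q) \<in> sigma {0<..} ?E \<rightarrow>\<^sub>M pos_reals"
      by (rule measurable_pos_realsI) (simp add: space_measure_of_conv)
    note id = this
    have "S \<in> sets (sigma {0<..} ?E)" if "S \<in> sets pos_reals" for S
    proof -
      have "S \<subseteq> {0<..}" using sets.sets_into_space[OF that] by simp
      then have "(\<lambda>q. q) -` S \<inter> space (sigma {0<..} ?E) = S"
        by (auto simp: space_measure_of_conv)
      then show ?thesis using measurable_sets[OF id that] by metis
    qed
    moreover have "sets (sigma {0<..} ?E) = sigma_sets {0<..} ?E" by (rule sets_measure_of) auto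
    ultimately show "sets pos_reals \<subseteq> sigma_sets {0<..} ?E" by auto
    have "?E \<subseteq> sets pos_reals" by (auto simp: sets_restrict_space)
    then show "sigma_sets {0<..} ?E \<subseteq> sets pos_reals"
      using sets.sigma_sets_subset[of ?E pos_reals] by simp
  qed
  show "sets \<mu> = sigma_sets {0<..} ?E" "sets \<nu> = sigma_sets {0<..} ?E"
    using s eqs by auto
  show "Int_stable ?E"
  proof (rule Int_stableI_image)
    fix p q :: real assume "p \<in> \<rat>" "q \<in> \<rat>"
    then show "\<exists>r\<in>\<rat>. {p<..} \<inter> {0<..} \<inter> ({q<..} \<inter> {0<..}) = {r<..} \<inter> {0<..}"
      by (intro bexI[of _ "max p q"]) (auto simp: max_def)
  qed
  show "range (\<lambda>_. {0<..}) \<subseteq> ?E" by (auto intro!: image_eqI[of _ _ 0])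
qed (use eq assms(3) in \<open>auto simp: finite_measure.emeasure_eq_measure\<close>)

text \<open>
  The sets of the positive reals are generated by countably many rays, so the countably many null sets on
  which the densities of two families may differ can be discarded together.
\<close>

lemma measure_family_unique:
  assumes "sigma_finite_measure B" and k: "measure_family B m k" "measure_family B m k'"
  shows "AE b in B. k b = k' b"
proof -
  interpret sigma_finite_measure B by fact
  have "AE b in B. \<forall>q\<in>\<rat>. emeasure (k b) ({q<..} \<inter> {0<..}) = emeasure (k' b) ({q<..} \<inter> {0<..})"
  proof (subst AE_ball_countable[OF countable_rat], intro ballI density_unique2)
    fix q :: real
    have S: "{q<..} \<inter> {0<..} \<in> sets pos_reals" by (auto simp: sets_restrict_space)
    show "(\<lambda>b. emeasure (k b) ({q<..} \<inter> {0<..})) \<in> borel_measurable B"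
      "(\<lambda>b. emeasure (k' b) ({q<..} \<inter> {0<..})) \<in> borel_measurable B"
      using k S unfolding measure_family_def by blast+
    show "(\<integral>\<^sup>+b\<in>N. emeasure (k b) ({q<..} \<inter> {0<..}) \<partial>B) = (\<integral>\<^sup>+b\<in>N. emeasure (k' b) ({q<..} \<inter> {0<..}) \<partial>B)"
      if "N \<in> sets B" for N
      using k S that unfolding measure_family_def by metis
  qed
  moreover have "AE b in B. k b \<in> M_tri" "AE b in B. k' b \<in> M_tri"
    using k by (simp_all add: measure_family_def)
  ultimately show ?thesis
  proof eventually_elim
    case (elim b)
    then show ?case
      by (intro measure_eqI_rat_pos_reals) (auto simp: M_tri_def intro!: finite_measureI)
  qed
qed

lemma emeasure_mult_convolution:
  assumes q: "sets q = sets pos_reals" and p: "sets p = sets pos_reals"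
    and "sigma_finite_measure p" and S[measurable]: "S \<in> sets pos_reals"
  shows "emeasure (mult_convolution q p) S = (\<integral>\<^sup>+s. \<integral>\<^sup>+t. indicator S (s * t) \<partial>p \<partial>q)"
proof -
  interpret p: sigma_finite_measure p by fact
  note [measurable_cong] = q p
  have m[measurable]: "(\<lambda>(s, t). s * t) \<in> q \<Otimes>\<^sub>M p \<rightarrow>\<^sub>M pos_reals"
    unfolding split_beta' by measurable
  have "emeasure (mult_convolution q p) S
      = (\<integral>\<^sup>+z. indicator S (case z of (s, t) \<Rightarrow> s * t) \<partial>(q \<Otimes>\<^sub>M p))"
    unfolding mult_convolution_def
    by (subst nn_integral_distr[OF m, symmetric]) auto
  also have "\<dots> = (\<integral>\<^sup>+s. \<integral>\<^sup>+t. indicator S (s * t) \<partial>p \<partial>q)"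
    by (subst p.nn_integral_fst[symmetric]) auto
  finally show ?thesis .
qed

lemma nn_integral_finite_kernel_swap:
  assumes k: "finite_kernel X Y k" "x \<in> space X" and k': "finite_kernel X' Y' k'" "x' \<in> space X'"
    and h: "(\<lambda>(y, y'). h y y') \<in> borel_measurable (Y \<Otimes>\<^sub>M Y')"
  shows "(\<integral>\<^sup>+y. \<integral>\<^sup>+y'. h y y' \<partial>k' x' \<partial>k x) = (\<integral>\<^sup>+y'. \<integral>\<^sup>+y. h y y' \<partial>k x \<partial>k' x')"
proof -
  interpret k: finite_measure "k x" by (rule finite_measure_finite_kernel[OF k])
  interpret k': finite_measure "k' x'" by (rule finite_measure_finite_kernel[OF k'])
  interpret pair_sigma_finite "k x" "k' x'" ..
  note [measurable_cong] = sets_finite_kernel[OF k] sets_finite_kernel[OF k']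
  note h[measurable]
  show ?thesis
    by (rule Fubini'[symmetric]) measurable
qed

section \<open>Polymorphisms\<close>

lemma sets_Pol: "P \<in> Pol A B \<Longrightarrow> sets P = sets (A \<Otimes>\<^sub>M B \<Otimes>\<^sub>M pos_reals)"
  by (simp add: Pol_def)

lemma space_Pol: "P \<in> Pol A B \<Longrightarrow> space P = space A \<times> space B \<times> {0<..}"
  using sets_eq_imp_space_eq[OF sets_Pol] by (simp add: space_pair_measure)

lemma nn_integral_Pol_source:
  assumes P: "P \<in> Pol A B" and h[measurable]: "h \<in> borel_measurable A"
  shows "(\<integral>\<^sup>+z. h (fst z) \<partial>P) = (\<integral>\<^sup>+a. h a \<partial>A)"
proof -
  note [measurable_cong] = sets_Pol[OF P]
  have "distr P A fst = A" using P by (simp add: Pol_def split_beta' cong: distr_cong)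
  then have "(\<integral>\<^sup>+a. h a \<partial>A) = (\<integral>\<^sup>+a. h a \<partial>distr P A fst)" by simp
  then show ?thesis by (simp add: nn_integral_distr)
qed

lemma nn_integral_Pol_target:
  assumes P: "P \<in> Pol A B" and h[measurable]: "h \<in> borel_measurable B"
  shows "(\<integral>\<^sup>+z. ennreal (snd (snd z)) * h (fst (snd z)) \<partial>P) = (\<integral>\<^sup>+b. h b \<partial>B)"
proof -
  note [measurable_cong] = sets_Pol[OF P]
  have "distr (density P (\<lambda>z. ennreal (snd (snd z)))) B (\<lambda>z. fst (snd z)) = B"
    using P by (simp add: Pol_def split_beta')
  then have "(\<integral>\<^sup>+b. h b \<partial>B)
      = (\<integral>\<^sup>+b. h b \<partial>distr (density P (\<lambda>z. ennreal (snd (snd z)))) B (\<lambda>z. fst (snd z)))" by simp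
  then show ?thesis by (simp add: nn_integral_distr nn_integral_density)
qed

lemma finite_measure_Pol:
  assumes P: "P \<in> Pol A B" and "finite_measure A"
  shows "finite_measure P"
proof -
  interpret finite_measure A by fact
  have "emeasure P (space P) = (\<integral>\<^sup>+z. 1 \<partial>P)" by simp
  also have "\<dots> = emeasure A (space A)"
    using nn_integral_Pol_source[OF P, of "\<lambda>_. 1"] by simp
  finally show ?thesis by (intro finite_measureI) simp
qed

lemma AE_Pol_source:
  assumes P: "P \<in> Pol A B" and N: "N \<in> null_sets A"
  shows "AE z in P. fst z \<notin> N"
proof -
  note [measurable_cong] = sets_Pol[OF P]
  have [measurable]: "N \<in> sets A" using N by auto
  have "(\<integral>\<^sup>+z. indicator N (fst z) \<partial>P) = (\<integral>\<^sup>+a. indicator N a \<partial>A)"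
    by (rule nn_integral_Pol_source[OF P]) measurable
  also have "\<dots> = 0" using N by auto
  finally have "AE z in P. indicator N (fst z) = (0 :: ennreal)"
    by (subst (asm) nn_integral_0_iff_AE) auto
  then show ?thesis by (auto elim!: eventually_mono simp: indicator_def split: if_splits)
qed

text \<open>
  Only the \<open>t\<close>-weighted image of \<open>P\<close> on \<open>B\<close> is \<open>B\<close>, but \<open>t > 0\<close>, so the unweighted
  image is absolutely continuous as well.
\<close>

lemma AE_Pol_target:
  assumes P: "P \<in> Pol A B" and N: "N \<in> null_sets B"
  shows "AE z in P. fst (snd z) \<notin> N"
proof -
  note [measurable_cong] = sets_Pol[OF P]
  have [measurable]: "N \<in> sets B" using N by auto
  have "(\<integral>\<^sup>+z. ennreal (snd (snd z)) * indicator N (fst (snd z)) \<partial>P) = (\<integral>\<^sup>+b. indicator N b \<partial>B)"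
    by (rule nn_integral_Pol_target[OF P]) measurable
  also have "\<dots> = 0" using N by auto
  finally have "AE z in P. ennreal (snd (snd z)) * indicator N (fst (snd z)) = 0"
    by (subst (asm) nn_integral_0_iff_AE) auto
  then show ?thesis using AE_space
    by eventually_elim (auto simp: indicator_def space_Pol[OF P] split: if_splits)
qed

lemma emeasure_Pol_rectangle:
  assumes P: "P \<in> Pol A B" and [measurable]: "M \<in> sets A" "N \<in> sets B" "S \<in> sets pos_reals"
  shows "emeasure P (M \<times> N \<times> S)
    = (\<integral>\<^sup>+z. indicator M (fst z) * indicator N (fst (snd z)) * indicator S (snd (snd z)) \<partial>P)"
proof -
  have "M \<times> N \<times> S \<in> sets P" by (simp add: sets_Pol[OF P])
  then have "emeasure P (M \<times> N \<times> S) = (\<integral>\<^sup>+z. indicator (M \<times> N \<times> S) z \<partial>P)" by simp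
  also have "\<dots> = (\<integral>\<^sup>+z. indicator M (fst z) * indicator N (fst (snd z)) * indicator S (snd (snd z)) \<partial>P)"
    by (intro nn_integral_cong) (auto simp: indicator_def)
  finally show ?thesis .
qed

lemma emeasure_slice:
  assumes P: "P \<in> Pol A B" and [measurable]: "M \<in> sets A" "N \<in> sets B" "S \<in> sets pos_reals"
  shows "emeasure (slice P M N) S = emeasure P (M \<times> N \<times> S)"
proof -
  note sP[measurable_cong] = sets_Pol[OF P]
  have top: "{0<..} \<in> sets pos_reals" using sets.top[of pos_reals] by simp
  have E: "M \<times> N \<times> {0<..} \<in> sets P" using top by (simp add: sP)
  have sub: "M \<subseteq> space A" "N \<subseteq> space B" "S \<subseteq> {0<..}"
    using assms(2-4)[THEN sets.sets_into_space] by auto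
  have "(\<lambda>(a, b, t). t) \<in> restrict_space P (M \<times> N \<times> {0<..}) \<rightarrow>\<^sub>M pos_reals"
    unfolding split_beta' by (rule measurable_restrict_space1) measurable
  then have "emeasure (slice P M N) S = emeasure (restrict_space P (M \<times> N \<times> {0<..}))
      ((\<lambda>(a, b, t). t) -` S \<inter> space (restrict_space P (M \<times> N \<times> {0<..})))"
    unfolding slice_def by (rule emeasure_distr) fact
  also have "(\<lambda>(a, b, t). t) -` S \<inter> space (restrict_space P (M \<times> N \<times> {0<..})) = M \<times> N \<times> S"
    using sub by (auto simp: space_restrict_space space_Pol[OF P])
  also have "emeasure (restrict_space P (M \<times> N \<times> {0<..})) \<dots> = emeasure P (M \<times> N \<times> S)"
    by (rule emeasure_restrict_space) (use E sub in auto)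
  finally show ?thesis .
qed

text \<open>
  The densities \<open>p_{M,b}\<close> and \<open>q_{b,K}\<close> of the product formula arise from the same construction over
  \<open>B\<close>, which is the target of \<open>P\<close> and the source of \<open>Q\<close>.
\<close>

definition target_fibres :: "'b measure \<Rightarrow> ('a \<times> 'b \<times> real) measure \<Rightarrow> 'a set \<Rightarrow> ('b \<Rightarrow> real measure) \<Rightarrow> bool" where
  "target_fibres B P M = fibre_family B P {z \<in> space P. fst z \<in> M} snd"

definition source_fibres :: "'b measure \<Rightarrow> ('b \<times> 'c \<times> real) measure \<Rightarrow> 'c set \<Rightarrow> ('b \<Rightarrow> real measure) \<Rightarrow> bool" where
  "source_fibres B Q K = fibre_family B Q {z \<in> space Q. fst (snd z) \<in> K} (\<lambda>z. (fst z, snd (snd z)))"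

lemma nn_integral_target_fibres:
  assumes "target_fibres B P M p" "(\<lambda>(b, t). h b t) \<in> borel_measurable (B \<Otimes>\<^sub>M pos_reals)"
  shows "(\<integral>\<^sup>+z. h (fst (snd z)) (snd (snd z)) * indicator M (fst z) \<partial>P) = (\<integral>\<^sup>+b. \<integral>\<^sup>+t. h b t \<partial>p b \<partial>B)"
  unfolding nn_integral_fibre_family[OF assms(1)[unfolded target_fibres_def] assms(2), symmetric]
  by (intro nn_integral_cong) (auto simp: indicator_def)

lemma nn_integral_source_fibres:
  assumes "source_fibres B Q K q" "(\<lambda>(b, s). h b s) \<in> borel_measurable (B \<Otimes>\<^sub>M pos_reals)"
  shows "(\<integral>\<^sup>+z. h (fst z) (snd (snd z)) * indicator K (fst (snd z)) \<partial>Q) = (\<integral>\<^sup>+b. \<integral>\<^sup>+s. h b s \<partial>q b \<partial>B)"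
  unfolding nn_integral_fibre_family[OF assms(1)[unfolded source_fibres_def] assms(2), symmetric]
  by (intro nn_integral_cong) (auto simp: indicator_def)

lemma target_fibres_kernel: "target_fibres B P M p \<Longrightarrow> finite_kernel B pos_reals p"
  unfolding target_fibres_def by (rule fibre_family_kernel)

lemma source_fibres_kernel: "source_fibres B Q K q \<Longrightarrow> finite_kernel B pos_reals q"
  unfolding source_fibres_def by (rule fibre_family_kernel)

lemma target_fibres_exist:
  assumes P: "P \<in> Pol A B" and A: "finite_measure A" and B: "finite_measure B" and [measurable]: "M \<in> sets A"
  obtains p where "target_fibres B P M p"
proof -
  note [measurable_cong] = sets_Pol[OF P]
  have [measurable]: "{z \<in> space P. fst z \<in> M} \<in> sets P" "snd \<in> P \<rightarrow>\<^sub>M B \<Otimes>\<^sub>M pos_reals"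
    by measurable
  show ?thesis
    by (rule fibre_family_exists[of B P "{z \<in> space P. fst z \<in> M}" snd])
      (auto intro: that AE_Pol_target[OF P] finite_measure_Pol[OF P A]
        finite_measure.sigma_finite_measure[OF B] simp: target_fibres_def)
qed

lemma source_fibres_exist:
  assumes Q: "Q \<in> Pol B C" and B: "finite_measure B" and [measurable]: "K \<in> sets C"
  obtains q where "source_fibres B Q K q"
proof -
  note [measurable_cong] = sets_Pol[OF Q]
  have [measurable]: "{z \<in> space Q. fst (snd z) \<in> K} \<in> sets Q"
    "(\<lambda>z. (fst z, snd (snd z))) \<in> Q \<rightarrow>\<^sub>M B \<Otimes>\<^sub>M pos_reals"
    by measurable
  show ?thesis
    by (rule fibre_family_exists[of B Q "{z \<in> space Q. fst (snd z) \<in> K}" "\<lambda>z. (fst z, snd (snd z))"])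
      (auto intro: that AE_Pol_source[OF Q] finite_measure_Pol[OF Q B]
        finite_measure.sigma_finite_measure[OF B] simp: source_fibres_def)
qed

lemma nn_integral_coordinate_finite:
  assumes P: "P \<in> Pol A B" and B: "finite_measure B"
  shows "(\<integral>\<^sup>+z\<in>E. ennreal (snd (snd z)) \<partial>P) < \<infinity>"
proof -
  interpret B: finite_measure B by fact
  have "(\<integral>\<^sup>+z\<in>E. ennreal (snd (snd z)) \<partial>P) \<le> (\<integral>\<^sup>+z. ennreal (snd (snd z)) * 1 \<partial>P)"
    by (intro nn_integral_mono) (auto simp: indicator_def)
  also have "\<dots> = emeasure B (space B)"
    using nn_integral_Pol_target[OF P, of "\<lambda>_. 1"] by simp
  finally show ?thesis by (rule le_less_trans) (simp add: less_top[symmetric])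
qed

lemma measure_family_target_fibres:
  assumes P: "P \<in> Pol A B" and B: "finite_measure B" and M[measurable]: "M \<in> sets A"
    and p: "target_fibres B P M p"
  shows "measure_family B (\<lambda>N. slice P M N) p"
proof (rule measure_family_fibre_family[OF p[unfolded target_fibres_def]])
  note [measurable_cong] = sets_Pol[OF P]
  show "{z \<in> space P. fst z \<in> M} \<in> sets P" "snd \<in> P \<rightarrow>\<^sub>M B \<Otimes>\<^sub>M pos_reals" by measurable
  show "(\<integral>\<^sup>+z\<in>{z \<in> space P. fst z \<in> M}. ennreal (snd (snd z)) \<partial>P) < \<infinity>"
    by (rule nn_integral_coordinate_finite[OF P B])
  fix N S assume NS: "N \<in> sets B" "S \<in> sets pos_reals"
  show "emeasure (slice P M N) S = (\<integral>\<^sup>+z\<in>{z \<in> space P. fst z \<in> M}.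
      indicator N (fst (snd z)) * indicator S (snd (snd z)) \<partial>P)"
    unfolding emeasure_slice[OF P M NS] emeasure_Pol_rectangle[OF P M NS]
    by (intro nn_integral_cong) (auto simp: indicator_def)
qed

lemma measure_family_source_fibres:
  assumes Q: "Q \<in> Pol B C" and C: "finite_measure C" and K[measurable]: "K \<in> sets C"
    and q: "source_fibres B Q K q"
  shows "measure_family B (\<lambda>N. slice Q N K) q"
proof (rule measure_family_fibre_family[OF q[unfolded source_fibres_def]])
  note [measurable_cong] = sets_Pol[OF Q]
  show "{z \<in> space Q. fst (snd z) \<in> K} \<in> sets Q"
    "(\<lambda>z. (fst z, snd (snd z))) \<in> Q \<rightarrow>\<^sub>M B \<Otimes>\<^sub>M pos_reals" by measurable
  show "(\<integral>\<^sup>+z\<in>{z \<in> space Q. fst (snd z) \<in> K}. ennreal (snd (fst z, snd (snd z))) \<partial>Q) < \<infinity>"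
    using nn_integral_coordinate_finite[OF Q C] by simp
  fix N S assume NS: "N \<in> sets B" "S \<in> sets pos_reals"
  show "emeasure (slice Q N K) S = (\<integral>\<^sup>+z\<in>{z \<in> space Q. fst (snd z) \<in> K}.
      indicator N (fst (fst z, snd (snd z))) * indicator S (snd (fst z, snd (snd z))) \<partial>Q)"
    unfolding emeasure_slice[OF Q NS(1) K NS(2)] emeasure_Pol_rectangle[OF Q NS(1) K NS(2)]
    by (intro nn_integral_cong) (auto simp: indicator_def)
qed

text \<open>
  The integral that defines the product needs fibres of only one of the two factors: integrating out the fibres
  of \<open>Q\<close> over \<open>B\<close> gives back an integral over \<open>Q\<close> itself, and, after exchanging the two
  integrations, the same is possible with \<open>P\<close>. Associativity rests on this freedom.
\<close>

lemma nn_integral_convolution_of_fibres: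
  assumes p: "target_fibres B P M p" and q: "source_fibres B Q K q" and S[measurable]: "S \<in> sets pos_reals"
  shows "(\<integral>\<^sup>+b. emeasure (mult_convolution (q b) (p b)) S \<partial>B)
      = (\<integral>\<^sup>+z. (\<integral>\<^sup>+t. indicator S (snd (snd z) * t) \<partial>p (fst z)) * indicator K (fst (snd z)) \<partial>Q)"
    and "(\<integral>\<^sup>+b. emeasure (mult_convolution (q b) (p b)) S \<partial>B)
      = (\<integral>\<^sup>+z. (\<integral>\<^sup>+s. indicator S (s * snd (snd z)) \<partial>q (fst (snd z))) * indicator M (fst z) \<partial>P)"
proof -
  note pk = target_fibres_kernel[OF p] and qk = source_fibres_kernel[OF q]
  have conv: "emeasure (mult_convolution (q b) (p b)) S = (\<integral>\<^sup>+s. \<integral>\<^sup>+t. indicator S (s * t) \<partial>p b \<partial>q b)"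
    if "b \<in> space B" for b
    using that by (intro emeasure_mult_convolution S sets_finite_kernel[OF pk] sets_finite_kernel[OF qk]
        finite_measure.sigma_finite_measure finite_measure_finite_kernel[OF pk])
  have "(\<integral>\<^sup>+b. emeasure (mult_convolution (q b) (p b)) S \<partial>B)
      = (\<integral>\<^sup>+b. \<integral>\<^sup>+s. \<integral>\<^sup>+t. indicator S (s * t) \<partial>p b \<partial>q b \<partial>B)"
    by (intro nn_integral_cong conv)
  also have "\<dots> = (\<integral>\<^sup>+z. (\<integral>\<^sup>+t. indicator S (snd (snd z) * t) \<partial>p (fst z)) * indicator K (fst (snd z)) \<partial>Q)"
  proof (rule nn_integral_source_fibres[OF q, symmetric])
    show "(\<lambda>(b, s). \<integral>\<^sup>+t. indicator S (s * t) \<partial>p b) \<in> borel_measurable (B \<Otimes>\<^sub>M pos_reals)"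
      unfolding split_beta' by (rule measurable_nn_integral_finite_kernel[OF pk]) measurable
  qed
  finally show "(\<integral>\<^sup>+b. emeasure (mult_convolution (q b) (p b)) S \<partial>B)
      = (\<integral>\<^sup>+z. (\<integral>\<^sup>+t. indicator S (snd (snd z) * t) \<partial>p (fst z)) * indicator K (fst (snd z)) \<partial>Q)" .
  have "(\<integral>\<^sup>+b. emeasure (mult_convolution (q b) (p b)) S \<partial>B)
      = (\<integral>\<^sup>+b. \<integral>\<^sup>+t. \<integral>\<^sup>+s. indicator S (s * t) \<partial>q b \<partial>p b \<partial>B)"
    by (intro nn_integral_cong, subst conv, assumption,
        rule nn_integral_finite_kernel_swap[OF qk _ pk]) (auto simp: split_beta')
  also have "\<dots> = (\<integral>\<^sup>+z. (\<integral>\<^sup>+s. indicator S (s * snd (snd z)) \<partial>q (fst (snd z))) * indicator M (fst z) \<partial>P)"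
  proof (rule nn_integral_target_fibres[OF p, symmetric])
    show "(\<lambda>(b, t). \<integral>\<^sup>+s. indicator S (s * t) \<partial>q b) \<in> borel_measurable (B \<Otimes>\<^sub>M pos_reals)"
      unfolding split_beta' by (rule measurable_nn_integral_finite_kernel[OF qk]) measurable
  qed
  finally show "(\<integral>\<^sup>+b. emeasure (mult_convolution (q b) (p b)) S \<partial>B)
      = (\<integral>\<^sup>+z. (\<integral>\<^sup>+s. indicator S (s * snd (snd z)) \<partial>q (fst (snd z))) * indicator M (fst z) \<partial>P)" .
qed

section \<open>The product formula\<close>

text \<open>
  The definition of the product asserts that some families compute it; by uniqueness up to null sets, all
  families do.
\<close>

lemma is_pol_product_fibres:
  assumes "finite_measure B" "finite_measure C" and P: "P \<in> Pol A B" and Q: "Q \<in> Pol B C"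
    and R: "is_pol_product A B C Q P R"
    and M: "M \<in> sets A" and K: "K \<in> sets C" and S: "S \<in> sets pos_reals"
    and p: "target_fibres B P M p" and q: "source_fibres B Q K q"
  shows "emeasure R (M \<times> K \<times> S) = (\<integral>\<^sup>+b. emeasure (mult_convolution (q b) (p b)) S \<partial>B)"
proof -
  interpret B: finite_measure B by fact
  have RP: "R \<in> Pol A C" using R by (simp add: is_pol_product_def)
  obtain p' q' where "measure_family B (\<lambda>N. slice P M N) p'" "measure_family B (\<lambda>N. slice Q N K) q'"
    and e: "emeasure (slice R M K) S = (\<integral>\<^sup>+b. emeasure (mult_convolution (q' b) (p' b)) S \<partial>B)"
    using R M K S unfolding is_pol_product_def by meson
  then have "AE b in B. p' b = p b" "AE b in B. q' b = q b"
    using measure_family_target_fibres[OF P assms(1) M p] measure_family_source_fibres[OF Q assms(2) K q]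
    by (auto intro!: measure_family_unique B.sigma_finite_measure)
  then have "(\<integral>\<^sup>+b. emeasure (mult_convolution (q' b) (p' b)) S \<partial>B)
      = (\<integral>\<^sup>+b. emeasure (mult_convolution (q b) (p b)) S \<partial>B)"
    by (intro nn_integral_cong_AE) auto
  with e show ?thesis by (simp add: emeasure_slice[OF RP M K S])
qed

lemma is_pol_productI:
  assumes A: "finite_measure A" and B: "finite_measure B" and C: "finite_measure C"
    and P: "P \<in> Pol A B" and Q: "Q \<in> Pol B C" and R: "R \<in> Pol A C"
    and *: "\<And>M K S p. M \<in> sets A \<Longrightarrow> K \<in> sets C \<Longrightarrow> S \<in> sets pos_reals \<Longrightarrow> target_fibres B P M p \<Longrightarrow>
      emeasure R (M \<times> K \<times> S)
      = (\<integral>\<^sup>+z. (\<integral>\<^sup>+t. indicator S (snd (snd z) * t) \<partial>p (fst z)) * indicator K (fst (snd z)) \<partial>Q)"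
  shows "is_pol_product A B C Q P R"
  unfolding is_pol_product_def
proof (intro conjI ballI R)
  fix M K assume M: "M \<in> sets A" and K: "K \<in> sets C"
  obtain p where p: "target_fibres B P M p" by (rule target_fibres_exist[OF P A B M])
  obtain q where q: "source_fibres B Q K q" by (rule source_fibres_exist[OF Q B K])
  show "\<exists>p q. measure_family B (\<lambda>N. slice P M N) p \<and> measure_family B (\<lambda>N. slice Q N K) q \<and>
      (\<forall>S\<in>sets pos_reals. emeasure (slice R M K) S = (\<integral>\<^sup>+b. emeasure (mult_convolution (q b) (p b)) S \<partial>B))"
    using measure_family_target_fibres[OF P B M p] measure_family_source_fibres[OF Q C K q]
      *[OF M K _ p] nn_integral_convolution_of_fibres(1)[OF p q]
    by (intro exI[of _ p] exI[of _ q]) (simp add: emeasure_slice[OF R M K])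
qed

lemma is_pol_product_unique:
  assumes A: "finite_measure A" and B: "finite_measure B" and C: "finite_measure C"
    and P: "P \<in> Pol A B" and Q: "Q \<in> Pol B C"
    and R: "is_pol_product A B C Q P R" "is_pol_product A B C Q P R'"
  shows "R = R'"
proof (rule measure_eq_on_triple_rectangles)
  have RP: "R \<in> Pol A C" "R' \<in> Pol A C" using R by (simp_all add: is_pol_product_def)
  show "sets R = sets (A \<Otimes>\<^sub>M C \<Otimes>\<^sub>M pos_reals)" "sets R' = sets (A \<Otimes>\<^sub>M C \<Otimes>\<^sub>M pos_reals)"
    using RP by (simp_all add: sets_Pol)
  show "finite_measure R" by (rule finite_measure_Pol[OF RP(1) A])
  fix M K S assume MKS: "M \<in> sets A" "K \<in> sets C" "S \<in> sets pos_reals"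
  obtain p where p: "target_fibres B P M p" by (rule target_fibres_exist[OF P A B MKS(1)])
  obtain q where q: "source_fibres B Q K q" by (rule source_fibres_exist[OF Q B MKS(2)])
  show "emeasure R (M \<times> K \<times> S) = emeasure R' (M \<times> K \<times> S)"
    using is_pol_product_fibres[OF B C P Q R(1) MKS p q] is_pol_product_fibres[OF B C P Q R(2) MKS p q]
    by simp
qed

section \<open>Existence of the product\<close>

lemma PolI:
  assumes s[measurable_cong]: "sets P = sets (A \<Otimes>\<^sub>M B \<Otimes>\<^sub>M pos_reals)"
    and A: "\<And>M. M \<in> sets A \<Longrightarrow> (\<integral>\<^sup>+z. indicator M (fst z) \<partial>P) = emeasure A M"
    and B: "\<And>N. N \<in> sets B \<Longrightarrow>
      (\<integral>\<^sup>+z. ennreal (snd (snd z)) * indicator N (fst (snd z)) \<partial>P) = emeasure B N"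
  shows "P \<in> Pol A B"
proof -
  have "distr P A fst = A"
  proof (rule measure_eqI)
    fix M assume "M \<in> sets (distr P A fst)"
    then have [measurable]: "M \<in> sets A" by simp
    have "emeasure (distr P A fst) M = (\<integral>\<^sup>+a. indicator M a \<partial>distr P A fst)" by simp
    also have "\<dots> = (\<integral>\<^sup>+z. indicator M (fst z) \<partial>P)" by (rule nn_integral_distr) measurable
    finally show "emeasure (distr P A fst) M = emeasure A M" by (simp add: A)
  qed simp
  moreover have "distr (density P (\<lambda>z. ennreal (snd (snd z)))) B (\<lambda>z. fst (snd z)) = B"
  proof (rule measure_eqI)
    let ?D = "distr (density P (\<lambda>z. ennreal (snd (snd z)))) B (\<lambda>z. fst (snd z))"
    fix N assume "N \<in> sets ?D"
    then have [measurable]: "N \<in> sets B" by simp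
    have "emeasure ?D N = (\<integral>\<^sup>+b. indicator N b \<partial>?D)" by simp
    also have "\<dots> = (\<integral>\<^sup>+z. ennreal (snd (snd z)) * indicator N (fst (snd z)) \<partial>P)"
      by (subst nn_integral_distr, measurable, rule nn_integral_density) measurable
    finally show "emeasure ?D N = emeasure B N" by (simp add: B)
  qed simp
  ultimately show ?thesis by (simp add: Pol_def s split_beta')
qed

lemma AE_Pol_target_transfer:
  assumes P: "P \<in> Pol A B" and "AE b in B. F b"
  shows "AE z in P. F (fst (snd z))"
proof -
  obtain N where N: "{b\<in>space B. \<not> F b} \<subseteq> N" "N \<in> null_sets B"
    using assms(2) by (auto simp: eventually_ae_filter)
  show ?thesis
    using AE_Pol_target[OF P N(2)] AE_space
    by eventually_elim (use N(1) in \<open>auto simp: space_Pol[OF P]\<close>)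
qed

text \<open>
  A Lebesgue space has a real coordinate \<open>\<phi>\<close> with an almost everywhere inverse \<open>\<psi>\<close>: place the
  segment and the atoms side by side on the real line. The sigma-algebra of \<open>C\<close> may be finer than the Borel
  structure (all Lebesgue sets, say), so \<open>\<psi>\<close> is measurable only with respect to the completed image
  measure.
\<close>

lemma lebesgue_measure_space_coordinate:
  fixes C :: "'c measure"
  assumes "lebesgue_measure_space C"
  obtains \<phi> :: "'c \<Rightarrow> real" and \<psi> where "\<phi> \<in> borel_measurable C"
    "\<psi> \<in> completion (distr C borel \<phi>) \<rightarrow>\<^sub>M C" "AE c in C. \<psi> (\<phi> c) = c"
proof -
  define L where "L = completion C"
  obtain u v I w where iso: "isomorphic_mod_0 L (segment_with_atoms u v I w)" and pos: "emeasure C (space C) > 0"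
    using assms unfolding lebesgue_measure_space_def L_def by blast
  define N where "N = segment_with_atoms u v I w"
  obtain X Y f g where X: "X \<in> null_sets L" and Y: "Y \<in> null_sets N"
    and f: "f \<in> restrict_space L (space L - X) \<rightarrow>\<^sub>M restrict_space N (space N - Y)"
    and g: "g \<in> restrict_space N (space N - Y) \<rightarrow>\<^sub>M restrict_space L (space L - X)"
    and gf: "\<And>x. x \<in> space (restrict_space L (space L - X)) \<Longrightarrow> g (f x) = x"
    and d: "distr (restrict_space L (space L - X)) (restrict_space N (space N - Y)) f = restrict_space N (space N - Y)"
    using iso unfolding isomorphic_mod_0_def N_def Let_def by blast
  define M' where "M' = restrict_space L (space L - X)"
  define N' where "N' = restrict_space N (space N - Y)"
  note f = f[folded M'_def N'_def] and g = g[folded M'_def N'_def] and gf = gf[folded M'_def]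
    and d = d[folded M'_def N'_def]
  have spL: "space L = space C" by (simp add: L_def)
  have spM': "space M' = space C - X" by (auto simp: M'_def space_restrict_space spL)
  have spN': "space N' = space N - Y" by (auto simp: N'_def space_restrict_space)
  have setM': "space L - X \<in> sets L" and setN': "space N - Y \<in> sets N" using X Y by auto
  have spN: "space N = {u..v} <+> I" by (simp add: N_def space_segment_with_atoms)
  have setsN: "Z \<in> sets N \<longleftrightarrow> Z \<subseteq> {u..v} <+> I \<and> Inl -` Z \<in> sets lebesgue" for Z
    by (simp add: N_def sets_segment_with_atoms)
  \<comment> \<open>The atoms go to \<open>v + 1, v + 2, ...\<close>, which lie to the right of the segment.\<close>
  define j :: "real + nat \<Rightarrow> real" where "j z = (case z of Inl x \<Rightarrow> x | Inr n \<Rightarrow> v + 1 + real n)" for z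
  have j: "inj_on j (space N)"
    by (rule inj_onI) (auto simp: spN j_def)
  have jm: "j \<in> borel_measurable N"
  proof (rule measurableI)
    fix S :: "real set" assume S: "S \<in> sets borel"
    have "Inl -` (j -` S \<inter> space N) = S \<inter> {u..v}" by (auto simp: spN j_def)
    then show "j -` S \<inter> space N \<in> sets N" using S by (auto simp: setsN spN)
  qed simp
  \<comment> \<open>The isomorphism lives on the completion; it is replaced by a function \<open>\<phi>\<close> that agrees
    with it almost everywhere and is measurable with respect to \<open>C\<close> itself.\<close>
  have "(\<lambda>c. j (f c)) \<in> borel_measurable M'"
    using f jm measurable_restrict_space1[OF jm, of "space N - Y"] by (auto simp: N'_def intro: measurable_compose)
  then have "(\<lambda>c. if c \<in> space L - X then j (f c) else 0) \<in> borel_measurable L"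
    unfolding M'_def by (subst (asm) measurable_restrict_space_iff) (use setM' in \<open>auto simp: Int_absorb2\<close>)
  from completion_ex_borel_measurable_real[OF this[unfolded L_def]] obtain \<phi>
    where \<phi>[measurable]: "\<phi> \<in> borel_measurable C"
      and h\<phi>: "AE c in C. (if c \<in> space L - X then j (f c) else 0) = \<phi> c"
    unfolding L_def by blast
  have "AE c in L. c \<notin> X" by (rule AE_not_in[OF X])
  then have "AE c in C. c \<notin> X" unfolding L_def AE_completion_iff .
  then have \<phi>: "AE c in C. c \<in> space M' \<and> \<phi> c = j (f c)"
    using h\<phi> AE_space by eventually_elim (auto simp: spM' spL split: if_splits)
  have "space C \<noteq> {}" using pos by auto
  then obtain c0 where c0: "c0 \<in> space C" by auto
  define \<psi> where "\<psi> y = (if y \<in> j ` space N' then g (the_inv_into (space N) j y) else c0)" for y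
  have \<psi>j: "\<psi> (j z) = g z" if "z \<in> space N'" for z
    using that the_inv_into_f_f[OF j, of z] by (auto simp: \<psi>_def spN')
  have "AE c in C. \<psi> (\<phi> c) = c"
    using \<phi> by eventually_elim (use measurable_space[OF f] gf in \<open>auto simp: \<psi>j\<close>)
  moreover
  define \<mu> where "\<mu> = distr C borel \<phi>"
  \<comment> \<open>The inverse image of a set under \<open>\<psi>\<close> is essentially the image under \<open>j\<close> of a set in the model. Such an
    image consists of a Borel set, a part of a Lebesgue null set inside the segment, and countably
    many points; the null set is also null for \<open>\<mu>\<close>, since \<open>f\<close> preserves measure.\<close>
  have image: "j ` Z \<in> sets (completion \<mu>)" if "Z \<in> sets N" for Z
  proof -
    define Z1 where "Z1 = Inl -` Z"
    have Z1: "Z1 \<in> sets (completion lborel)" "Z1 \<subseteq> {u..v}"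
      using that by (auto simp: setsN Z1_def)
    obtain S T T' where ST: "Z1 = S \<union> T" "S \<in> sets lborel" "T' \<in> null_sets lborel" "T \<subseteq> T'"
      using Z1(1) by (rule sets_completionE) blast
    define T'' where "T'' = T' \<inter> {u..v}"
    have T'': "T'' \<in> null_sets lborel" "T \<subseteq> T''" "T'' \<subseteq> {u..v}"
      using ST Z1(2) by (auto simp: T''_def intro: null_set_Int2)
    have InlT: "Inl ` T'' \<in> sets N"
    proof -
      have "Inl -` (Inl ` T'' :: (real + nat) set) = T''" by auto
      then show ?thesis using T'' by (auto simp: setsN)
    qed
    have "emeasure N (Inl ` T'') = emeasure lebesgue (Inl -` (Inl ` T'' :: (real + nat) set))
        + emeasure (point_measure I w) (Inr -` (Inl ` T'' :: (real + nat) set))"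
      using InlT unfolding N_def by (rule emeasure_segment_with_atoms)
    also have "Inl -` (Inl ` T'' :: (real + nat) set) = T''" by auto
    also have "Inr -` (Inl ` T'' :: (real + nat) set) = {}" by auto
    also have "emeasure lebesgue T'' = 0" using null_sets_completionI[OF T''(1)] by (rule null_setsD1)
    finally have "emeasure N (Inl ` T'') = 0" by simp
    then have "Inl ` T'' \<in> null_sets N" using InlT by auto
    from AE_not_in[OF this] have "AE z in N'. z \<notin> Inl ` T''"
      unfolding N'_def using setN' by (subst AE_restrict_space_iff) (auto elim!: eventually_mono)
    then have "AE z in distr M' N' f. z \<notin> Inl ` T''" by (simp only: d)
    then have "AE c in M'. f c \<notin> Inl ` T''" by (rule AE_distrD[OF f])
    then have "AE c in L. c \<in> space L - X \<longrightarrow> f c \<notin> Inl ` T''"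
      unfolding M'_def using setM' by (subst (asm) AE_restrict_space_iff) auto
    then have "AE c in C. c \<in> space L - X \<longrightarrow> f c \<notin> Inl ` T''"
      unfolding L_def AE_completion_iff .
    then have "AE c in C. \<phi> c \<notin> T''"
      using \<phi>
    proof eventually_elim
      case (elim c)
      then have c: "c \<in> space M'" "\<phi> c = j (f c)" "f c \<notin> Inl ` T''" by (auto simp: spM' spL)
      have "f c \<in> space N" using measurable_space[OF f c(1)] by (simp add: spN')
      then show ?case using c T''(3) by (auto simp: spN j_def split: sum.splits)
    qed
    then have "T'' \<in> null_sets \<mu>"
      unfolding \<mu>_def using T''(1)
      by (subst AE_iff_null_sets) (auto simp: AE_distr_iff null_sets_def)
    then have "S \<union> T \<in> sets (completion \<mu>)"
      using ST(2) T''(2) by (intro sets_completionI[of _ S T T'']) (auto simp: \<mu>_def)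
    moreover have "(\<lambda>n. v + 1 + real n) ` (Inr -` Z) \<in> sets borel"
      by (rule sets.countable) auto
    then have "(\<lambda>n. v + 1 + real n) ` (Inr -` Z) \<in> sets (completion \<mu>)"
      by (intro sets_completionI_sets) (simp add: \<mu>_def)
    moreover have "j ` Z = (S \<union> T) \<union> (\<lambda>n. v + 1 + real n) ` (Inr -` Z)"
    proof -
      have "Z = Inl ` Z1 \<union> Inr ` (Inr -` Z)"
        unfolding Z1_def by (auto simp: image_iff) (metis sum.exhaust)
      then have "j ` Z = j ` (Inl ` Z1) \<union> j ` (Inr ` (Inr -` Z))" by (metis image_Un)
      moreover have "j ` (Inl ` Z1) = Z1" by (simp add: image_image j_def)
      moreover have "j ` (Inr ` W) = (\<lambda>n. v + 1 + real n) ` W" for W by (simp add: image_image j_def)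
      ultimately show ?thesis unfolding ST(1)[symmetric] by metis
    qed
    ultimately show ?thesis by auto
  qed
  have "\<psi> \<in> completion \<mu> \<rightarrow>\<^sub>M C"
  proof (rule measurableI)
    show "\<psi> y \<in> space C" for y
      using measurable_space[OF g] c0 \<psi>j[of "the_inv_into (space N) j y"]
      by (cases "y \<in> j ` space N'") (auto simp: \<psi>j spM', auto simp: \<psi>_def)
    fix K assume K: "K \<in> sets C"
    define Z where "Z = g -` (K \<inter> space M') \<inter> space N'"
    have "K \<inter> space M' \<in> sets M'"
      using K unfolding M'_def by (auto simp: sets_restrict_space L_def space_restrict_space)
    then have "Z \<in> sets N'" unfolding Z_def by (rule measurable_sets[OF g])
    then have ZN: "Z \<in> sets N" "space N' \<in> sets N"
      using setN' by (auto simp: N'_def sets_restrict_space_iff space_restrict_space)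
    have "\<psi> -` K \<inter> space (completion \<mu>) = j ` Z \<union> (if c0 \<in> K then space (completion \<mu>) - j ` space N' else {})"
    proof -
      have "j z \<in> \<psi> -` K \<longleftrightarrow> j z \<in> j ` Z" if "z \<in> space N'" for z
      proof -
        have "j z \<in> j ` Z \<longleftrightarrow> z \<in> Z"
          using inj_on_image_mem_iff[OF j, of z Z] that by (auto simp: Z_def spN')
        then show ?thesis using that measurable_space[OF g that] by (simp add: \<psi>j Z_def)
      qed
      then have "y \<in> \<psi> -` K \<longleftrightarrow> y \<in> j ` Z" if "y \<in> j ` space N'" for y using that by auto
      moreover have "y \<notin> j ` Z \<and> (y \<in> \<psi> -` K \<longleftrightarrow> c0 \<in> K)" if "y \<notin> j ` space N'" for y
        using that by (auto simp: \<psi>_def Z_def)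
      ultimately show ?thesis
        by (simp add: \<mu>_def set_eq_iff) blast
    qed
    then show "\<psi> -` K \<inter> space (completion \<mu>) \<in> sets (completion \<mu>)"
      using image[OF ZN(1)] image[OF ZN(2)] by auto
  qed
  ultimately show ?thesis
    using that[of \<phi> \<psi>] \<open>\<phi> \<in> borel_measurable C\<close> by (simp add: \<mu>_def)
qed

text \<open>
  Given the conditional distributions \<open>\<kappa> b\<close> of \<open>Q\<close> on \<open>C \<times> (0,\<infinity>)\<close>, the product is the law of
  \<open>(a, c, s t)\<close>, where \<open>(a, b, t)\<close> is drawn from \<open>P\<close> and then \<open>(c, s)\<close> from \<open>\<kappa> b\<close>.
  Such conditional distributions need not exist on \<open>C\<close>: they may charge null sets of \<open>C\<close>, and so
  need not extend to all Lebesgue sets. Therefore the construction is carried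
  out with the real coordinate \<open>x = \<phi> c\<close>, giving a measure \<open>R0\<close> on \<open>A \<times> \<real> \<times> (0,\<infinity>)\<close>. After averaging over
  \<open>b\<close>, null sets of \<open>C\<close> are null for \<open>R0\<close>, hence the completion of \<open>R0\<close> can be
  carried back to \<open>C\<close> by \<open>\<psi>\<close>.
\<close>

lemma is_pol_product_exists:
  fixes A :: "'a measure" and B :: "'b measure" and C :: "'c measure"
  assumes A: "finite_measure A" and B: "finite_measure B" and leb: "lebesgue_measure_space C"
    and P: "P \<in> Pol A B" and Q: "Q \<in> Pol B C"
  obtains R where "is_pol_product A B C Q P R"
proof -
  note sP[measurable_cong] = sets_Pol[OF P] and sQ[measurable_cong] = sets_Pol[OF Q]
  have C: "finite_measure C" using leb by (simp add: lebesgue_measure_space_def)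
  interpret A: finite_measure A by fact
  obtain \<phi> :: "'c \<Rightarrow> real" and \<psi> where \<phi>[measurable]: "\<phi> \<in> borel_measurable C"
    and \<psi>: "\<psi> \<in> completion (distr C borel \<phi>) \<rightarrow>\<^sub>M C" and \<psi>\<phi>: "AE c in C. \<psi> (\<phi> c) = c"
    by (rule lebesgue_measure_space_coordinate[OF leb])
  define \<mu> where "\<mu> = distr C borel \<phi>"
  have s\<mu>[measurable_cong, simp]: "sets \<mu> = sets borel" by (simp add: \<mu>_def)
  have sp\<mu>[simp]: "space \<mu> = UNIV" by (simp add: \<mu>_def)
  define Q' where "Q' = distr Q (B \<Otimes>\<^sub>M borel \<Otimes>\<^sub>M pos_reals) (\<lambda>z. (fst z, \<phi> (fst (snd z)), snd (snd z)))"
  have sQ': "sets Q' = sets (B \<Otimes>\<^sub>M borel \<Otimes>\<^sub>M pos_reals)" by (simp add: Q'_def)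
  have "finite_measure Q'"
    unfolding Q'_def by (rule finite_measure.finite_measure_distr[OF finite_measure_Pol[OF Q B]]) measurable
  from disintegration_real_pos_reals[OF sQ' this]
  obtain \<kappa> where \<kappa>: "\<kappa> \<in> B \<rightarrow>\<^sub>M subprob_algebra (borel \<Otimes>\<^sub>M pos_reals)"
    and \<kappa>I: "\<And>h. h \<in> borel_measurable (B \<Otimes>\<^sub>M borel \<Otimes>\<^sub>M pos_reals) \<Longrightarrow>
       (\<integral>\<^sup>+z. h z \<partial>Q') = (\<integral>\<^sup>+b. \<integral>\<^sup>+y. h (b, y) \<partial>\<kappa> b \<partial>distr Q' B fst)"
    by blast
  note \<kappa>k = finite_kernel_subprob[OF \<kappa>]
  have "distr Q' B fst = distr Q B fst"
    unfolding Q'_def by (simp add: distr_distr comp_def)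
  also have "\<dots> = B" using Q by (simp add: Pol_def split_beta')
  finally have QI: "(\<integral>\<^sup>+z. h (fst z) (\<phi> (fst (snd z))) (snd (snd z)) \<partial>Q)
      = (\<integral>\<^sup>+b. \<integral>\<^sup>+y. h b (fst y) (snd y) \<partial>\<kappa> b \<partial>B)"
    if [measurable]: "(\<lambda>y. h (fst y) (fst (snd y)) (snd (snd y))) \<in> borel_measurable (B \<Otimes>\<^sub>M borel \<Otimes>\<^sub>M pos_reals)"
    for h :: "'b \<Rightarrow> real \<Rightarrow> real \<Rightarrow> ennreal"
    using \<kappa>I[OF that] unfolding Q'_def by (subst (asm) nn_integral_distr) auto
  obtain R0 where sR0[measurable_cong]: "sets R0 = sets (A \<Otimes>\<^sub>M borel \<Otimes>\<^sub>M pos_reals)"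
    and R0I: "\<And>h. h \<in> borel_measurable (A \<Otimes>\<^sub>M borel \<Otimes>\<^sub>M pos_reals) \<Longrightarrow> (\<integral>\<^sup>+w. h w \<partial>R0)
      = (\<integral>\<^sup>+z. \<integral>\<^sup>+y. h (fst z, fst y, snd y * snd (snd z)) \<partial>\<kappa> (fst (snd z)) \<partial>P)"
    by (rule kernel_image_measure[OF \<kappa>k, of "\<lambda>z. fst (snd z)" "A \<Otimes>\<^sub>M B \<Otimes>\<^sub>M pos_reals"
          "\<lambda>z y. (fst z, fst y, snd y * snd (snd z))" "A \<Otimes>\<^sub>M borel \<Otimes>\<^sub>M pos_reals" P])
      (measurable, rule sP, blast)
  have spR0: "space R0 = space A \<times> UNIV \<times> {0<..}"
    using sets_eq_imp_space_eq[OF sR0] by (simp add: space_pair_measure)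
  have s\<kappa>: "sets (\<kappa> b) = sets (borel \<Otimes>\<^sub>M pos_reals)" if "b \<in> space B" for b
    using sets_kernel[OF \<kappa> that] .

  \<comment> \<open>The product formula for \<open>R0\<close>, by exchanging the fibres of \<open>P\<close> with those of \<open>Q\<close>.\<close>
  have star: "(\<integral>\<^sup>+w. h (fst (snd w)) (snd (snd w)) * indicator M (fst w) \<partial>R0)
      = (\<integral>\<^sup>+z. \<integral>\<^sup>+t. h (\<phi> (fst (snd z))) (snd (snd z) * t) \<partial>p (fst z) \<partial>Q)"
    if h[measurable]: "(\<lambda>y. h (fst y) (snd y)) \<in> borel_measurable (borel \<Otimes>\<^sub>M pos_reals)"
      and M[measurable]: "M \<in> sets A" and p: "target_fibres B P M p"
    for h :: "real \<Rightarrow> real \<Rightarrow> ennreal" and M p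
  proof -
    note pk = target_fibres_kernel[OF p]
    have hm[measurable]: "(\<lambda>x. h (F x) (G x)) \<in> borel_measurable W"
      if "F \<in> borel_measurable W" "G \<in> W \<rightarrow>\<^sub>M pos_reals" for F G and W :: "'w measure"
      using measurable_compose[OF measurable_Pair[OF that] h] by simp
    have "(\<integral>\<^sup>+w. h (fst (snd w)) (snd (snd w)) * indicator M (fst w) \<partial>R0)
      = (\<integral>\<^sup>+z. \<integral>\<^sup>+y. h (fst y) (snd y * snd (snd z)) * indicator M (fst z) \<partial>\<kappa> (fst (snd z)) \<partial>P)"
      using R0I[of "\<lambda>w. h (fst (snd w)) (snd (snd w)) * indicator M (fst w)"] by simp
    also have "\<dots> = (\<integral>\<^sup>+z. (\<integral>\<^sup>+y. h (fst y) (snd y * snd (snd z)) \<partial>\<kappa> (fst (snd z))) * indicator M (fst z) \<partial>P)"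
      by (intro nn_integral_cong) (simp add: indicator_def)
    also have "\<dots> = (\<integral>\<^sup>+b. \<integral>\<^sup>+t. \<integral>\<^sup>+y. h (fst y) (snd y * t) \<partial>\<kappa> b \<partial>p b \<partial>B)"
    proof (rule nn_integral_target_fibres[OF p])
      show "(\<lambda>(b, t). \<integral>\<^sup>+y. h (fst y) (snd y * t) \<partial>\<kappa> b) \<in> borel_measurable (B \<Otimes>\<^sub>M pos_reals)"
        unfolding split_beta' by (rule measurable_nn_integral_finite_kernel[OF \<kappa>k])
          (auto simp: split_beta' intro!: hm)
    qed
    also have "\<dots> = (\<integral>\<^sup>+b. \<integral>\<^sup>+y. \<integral>\<^sup>+t. h (fst y) (snd y * t) \<partial>p b \<partial>\<kappa> b \<partial>B)"
      by (intro nn_integral_cong nn_integral_finite_kernel_swap[OF pk _ \<kappa>k])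
        (auto simp: split_beta' intro!: hm)
    also have "\<dots> = (\<integral>\<^sup>+z. \<integral>\<^sup>+t. h (\<phi> (fst (snd z))) (snd (snd z) * t) \<partial>p (fst z) \<partial>Q)"
    proof (rule QI[symmetric])
      show "(\<lambda>y. \<integral>\<^sup>+t. h (fst (snd y)) (snd (snd y) * t) \<partial>p (fst y)) \<in> borel_measurable (B \<Otimes>\<^sub>M borel \<Otimes>\<^sub>M pos_reals)"
        by (rule measurable_nn_integral_finite_kernel[OF pk]) (auto simp: split_beta' intro!: hm)
    qed
    finally show ?thesis .
  qed

  \<comment> \<open>For the constant function 1 the product formula loses its dependence on \<open>c\<close> and \<open>s\<close>, and the marginal of
    \<open>Q\<close> on \<open>B\<close> is \<open>B\<close>.\<close>
  have R0A: "(\<integral>\<^sup>+w. indicator M (fst w) \<partial>R0) = emeasure A M" if M[measurable]: "M \<in> sets A" for M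
  proof -
    obtain p where p: "target_fibres B P M p" by (rule target_fibres_exist[OF P A B M])
    have "(\<integral>\<^sup>+w. indicator M (fst w) \<partial>R0) = (\<integral>\<^sup>+z. \<integral>\<^sup>+t. 1 \<partial>p (fst z) \<partial>Q)"
      using star[of "\<lambda>_ _. 1", OF _ M p] by simp
    also have "\<dots> = (\<integral>\<^sup>+b. \<integral>\<^sup>+t. 1 \<partial>p b \<partial>B)"
      by (rule nn_integral_Pol_source[OF Q], rule measurable_nn_integral_finite_kernel[OF target_fibres_kernel[OF p]])
        auto
    also have "\<dots> = (\<integral>\<^sup>+z. indicator M (fst z) \<partial>P)"
      using nn_integral_target_fibres[OF p, of "\<lambda>_ _. 1"] by simp
    also have "\<dots> = (\<integral>\<^sup>+a. indicator M a \<partial>A)" by (rule nn_integral_Pol_source[OF P]) measurable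
    finally show ?thesis by simp
  qed
  have R0C: "(\<integral>\<^sup>+w. ennreal (snd (snd w)) * indicator S (fst (snd w)) \<partial>R0) = emeasure \<mu> S"
    if S[measurable]: "S \<in> sets borel" for S
  proof -
    have "(\<integral>\<^sup>+w. ennreal (snd (snd w)) * indicator S (fst (snd w)) \<partial>R0)
        = (\<integral>\<^sup>+z. \<integral>\<^sup>+y. ennreal (snd y * snd (snd z)) * indicator S (fst y) \<partial>\<kappa> (fst (snd z)) \<partial>P)"
      by (subst R0I) auto
    also have "\<dots> = (\<integral>\<^sup>+z. ennreal (snd (snd z)) * (\<integral>\<^sup>+y. ennreal (snd y) * indicator S (fst y) \<partial>\<kappa> (fst (snd z))) \<partial>P)"
    proof (rule nn_integral_cong)
      fix z assume "z \<in> space P"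
      then have z: "fst (snd z) \<in> space B" "0 < snd (snd z)" by (auto simp: space_Pol[OF P])
      note [measurable_cong] = s\<kappa>[OF z(1)]
      have "(\<integral>\<^sup>+y. ennreal (snd y * snd (snd z)) * indicator S (fst y) \<partial>\<kappa> (fst (snd z)))
          = (\<integral>\<^sup>+y. ennreal (snd (snd z)) * (ennreal (snd y) * indicator S (fst y)) \<partial>\<kappa> (fst (snd z)))"
      proof (rule nn_integral_cong)
        fix y assume "y \<in> space (\<kappa> (fst (snd z)))"
        then have "y \<in> space (borel \<Otimes>\<^sub>M pos_reals)"
          unfolding sets_eq_imp_space_eq[OF s\<kappa>[OF z(1)]] .
        then have "0 < snd y" by (cases y) (simp add: space_pair_measure)
        then have "ennreal (snd y * snd (snd z)) = ennreal (snd (snd z)) * ennreal (snd y)"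
          using z(2) by (simp only: mult.commute[of "snd y"] ennreal_mult less_imp_le)
        then show "ennreal (snd y * snd (snd z)) * indicator S (fst y)
            = ennreal (snd (snd z)) * (ennreal (snd y) * indicator S (fst y))"
          by (simp add: mult.assoc)
      qed
      also have "\<dots> = ennreal (snd (snd z)) * (\<integral>\<^sup>+y. ennreal (snd y) * indicator S (fst y) \<partial>\<kappa> (fst (snd z)))"
        by (rule nn_integral_cmult) measurable
      finally show "(\<integral>\<^sup>+y. ennreal (snd y * snd (snd z)) * indicator S (fst y) \<partial>\<kappa> (fst (snd z))) = \<dots>" .
    qed
    also have "\<dots> = (\<integral>\<^sup>+b. \<integral>\<^sup>+y. ennreal (snd y) * indicator S (fst y) \<partial>\<kappa> b \<partial>B)"
      by (rule nn_integral_Pol_target[OF P],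
          rule measurable_nn_integral_finite_kernel[OF \<kappa>k measurable_ident_sets[OF refl]])
        (unfold split_beta', measurable)
    also have "\<dots> = (\<integral>\<^sup>+z. ennreal (snd (snd z)) * indicator S (\<phi> (fst (snd z))) \<partial>Q)"
      by (rule QI[symmetric, of "\<lambda>b x s. ennreal s * indicator S x"]) measurable
    also have "\<dots> = (\<integral>\<^sup>+c. indicator S (\<phi> c) \<partial>C)"
      by (rule nn_integral_Pol_target[OF Q]) measurable
    also have "\<dots> = (\<integral>\<^sup>+x. indicator S x \<partial>\<mu>)" unfolding \<mu>_def by (subst nn_integral_distr) auto
    finally show ?thesis by simp
  qed
  have R0null: "AE w in R0. fst (snd w) \<notin> S" if S: "S \<in> null_sets \<mu>" for S
  proof -
    have [measurable]: "S \<in> sets borel" using S by auto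
    have "(\<integral>\<^sup>+w. ennreal (snd (snd w)) * indicator S (fst (snd w)) \<partial>R0) = 0"
      using S by (simp add: R0C null_setsD1)
    then have "AE w in R0. ennreal (snd (snd w)) * indicator S (fst (snd w)) = 0"
      by (subst (asm) nn_integral_0_iff_AE) auto
    then show ?thesis using AE_space
      by eventually_elim (auto simp: indicator_def spR0 split: if_splits)
  qed
  have \<psi>R: "(\<lambda>w. \<psi> (fst (snd w))) \<in> completion R0 \<rightarrow>\<^sub>M C"
  proof (rule measurable_compose[OF _ \<psi>[folded \<mu>_def]])
    have m: "(\<lambda>w. fst (snd w)) \<in> completion R0 \<rightarrow>\<^sub>M \<mu>"
      by (rule measurable_completion) measurable
    show "(\<lambda>w. fst (snd w)) \<in> completion R0 \<rightarrow>\<^sub>M completion \<mu>"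
    proof (rule completion.measurable_completion2[OF m], rule)
      fix S assume S: "S \<in> null_sets \<mu>"
      then have "AE w in completion R0. fst (snd w) \<notin> S" by (intro AE_completion R0null)
      then show "S \<in> null_sets (distr (completion R0) \<mu> (\<lambda>w. fst (snd w)))"
        using S m by (subst AE_iff_null_sets) (auto simp: AE_distr_iff)
    qed
  qed
  define \<Psi> where "\<Psi> w = (fst w, \<psi> (fst (snd w)), snd (snd w))" for w :: "'a \<times> real \<times> real"
  have \<Psi>: "\<Psi> \<in> completion R0 \<rightarrow>\<^sub>M A \<Otimes>\<^sub>M C \<Otimes>\<^sub>M pos_reals"
    unfolding \<Psi>_def by (intro measurable_Pair \<psi>R measurable_completion) measurable
  define R where "R = distr (completion R0) (A \<Otimes>\<^sub>M C \<Otimes>\<^sub>M pos_reals) \<Psi>"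
  have sR[measurable_cong]: "sets R = sets (A \<Otimes>\<^sub>M C \<Otimes>\<^sub>M pos_reals)" by (simp add: R_def)
  have RI: "(\<integral>\<^sup>+z. h z \<partial>R) = (\<integral>\<^sup>+w. h (\<Psi> w) \<partial>R0)"
    if "h \<in> borel_measurable (A \<Otimes>\<^sub>M C \<Otimes>\<^sub>M pos_reals)" for h
    unfolding R_def using \<Psi> that by (simp add: nn_integral_distr nn_integral_completion)
  \<comment> \<open>For integrals over \<open>R0\<close>, the condition \<open>\<psi> x \<in> K\<close> can be replaced by a Borel condition on \<open>x\<close>;
    for integrals over \<open>C\<close>, this Borel condition on \<open>\<phi> c\<close> means \<open>c \<in> K\<close>.\<close>
  have borel_rep: "\<exists>S\<in>sets borel. (AE w in R0. \<psi> (fst (snd w)) \<in> K \<longleftrightarrow> fst (snd w) \<in> S) \<and>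
      (AE c in C. c \<in> K \<longleftrightarrow> \<phi> c \<in> S)" if K: "K \<in> sets C" for K
  proof -
    have "\<psi> -` K \<in> sets (completion \<mu>)"
      using measurable_sets[OF \<psi>[folded \<mu>_def] K] by simp
    then obtain S T T' where ST: "\<psi> -` K = S \<union> T" "S \<in> sets \<mu>" "T' \<in> null_sets \<mu>" "T \<subseteq> T'"
      by (rule sets_completionE) blast
    have "AE w in R0. \<psi> (fst (snd w)) \<in> K \<longleftrightarrow> fst (snd w) \<in> S"
      using R0null[OF ST(3)] by eventually_elim (use ST(1,4) in auto)
    moreover have "AE x in \<mu>. x \<notin> T'" by (rule AE_not_in[OF ST(3)])
    then have "AE c in C. \<phi> c \<notin> T'" unfolding \<mu>_def by (rule AE_distrD[OF \<phi>])
    then have "AE c in C. c \<in> K \<longleftrightarrow> \<phi> c \<in> S"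
      using \<psi>\<phi>
    proof eventually_elim
      case (elim c)
      have "c \<in> K \<longleftrightarrow> \<phi> c \<in> \<psi> -` K" using elim(2) by simp
      also have "\<dots> \<longleftrightarrow> \<phi> c \<in> S" using ST(1,4) elim(1) by auto
      finally show ?case .
    qed
    ultimately show ?thesis using ST(2) by auto
  qed
  have RP: "R \<in> Pol A C"
  proof (rule PolI[OF sR])
    fix M assume M[measurable]: "M \<in> sets A"
    show "(\<integral>\<^sup>+z. indicator M (fst z) \<partial>R) = emeasure A M"
      by (subst RI) (auto simp: \<Psi>_def R0A M)
  next
    fix K assume K[measurable]: "K \<in> sets C"
    obtain S where S[measurable]: "S \<in> sets borel"
      and SR: "AE w in R0. \<psi> (fst (snd w)) \<in> K \<longleftrightarrow> fst (snd w) \<in> S"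
      and SC: "AE c in C. c \<in> K \<longleftrightarrow> \<phi> c \<in> S" using borel_rep[OF K] by blast
    have "(\<integral>\<^sup>+z. ennreal (snd (snd z)) * indicator K (fst (snd z)) \<partial>R)
        = (\<integral>\<^sup>+w. ennreal (snd (snd w)) * indicator K (\<psi> (fst (snd w))) \<partial>R0)"
      by (subst RI) (auto simp: \<Psi>_def)
    also have "\<dots> = (\<integral>\<^sup>+w. ennreal (snd (snd w)) * indicator S (fst (snd w)) \<partial>R0)"
      by (rule nn_integral_cong_AE) (use SR in \<open>eventually_elim, auto simp: indicator_def\<close>)
    also have "\<dots> = emeasure \<mu> S" by (rule R0C[OF S])
    also have "\<dots> = (\<integral>\<^sup>+x. indicator S x \<partial>\<mu>)" by simp
    also have "\<dots> = (\<integral>\<^sup>+c. indicator S (\<phi> c) \<partial>C)" unfolding \<mu>_def by (subst nn_integral_distr) auto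
    also have "\<dots> = (\<integral>\<^sup>+c. indicator K c \<partial>C)"
      by (rule nn_integral_cong_AE) (use SC in \<open>eventually_elim, auto simp: indicator_def\<close>)
    finally show "(\<integral>\<^sup>+z. ennreal (snd (snd z)) * indicator K (fst (snd z)) \<partial>R) = emeasure C K" by simp
  qed
  have "is_pol_product A B C Q P R"
  proof (rule is_pol_productI[OF A B C P Q RP])
    fix M K U p
    assume M[measurable]: "M \<in> sets A" and K[measurable]: "K \<in> sets C" and U[measurable]: "U \<in> sets pos_reals"
      and p: "target_fibres B P M p"
    note pk = target_fibres_kernel[OF p]
    obtain S where S[measurable]: "S \<in> sets borel"
      and SR: "AE w in R0. \<psi> (fst (snd w)) \<in> K \<longleftrightarrow> fst (snd w) \<in> S"
      and SC: "AE c in C. c \<in> K \<longleftrightarrow> \<phi> c \<in> S" using borel_rep[OF K] by blast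
    have "emeasure R (M \<times> K \<times> U)
        = (\<integral>\<^sup>+w. indicator M (fst w) * indicator K (\<psi> (fst (snd w))) * indicator U (snd (snd w)) \<partial>R0)"
      unfolding emeasure_Pol_rectangle[OF RP M K U] by (subst RI) (auto simp: \<Psi>_def)
    also have "\<dots> = (\<integral>\<^sup>+w. indicator S (fst (snd w)) * indicator U (snd (snd w)) * indicator M (fst w) \<partial>R0)"
      by (rule nn_integral_cong_AE) (use SR in \<open>eventually_elim, auto simp: indicator_def\<close>)
    also have "\<dots> = (\<integral>\<^sup>+z. \<integral>\<^sup>+t. indicator S (\<phi> (fst (snd z))) * indicator U (snd (snd z) * t) \<partial>p (fst z) \<partial>Q)"
      by (rule star[OF _ M p, of "\<lambda>x v. indicator S x * indicator U v"]) measurable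
    also have "\<dots> = (\<integral>\<^sup>+z. (\<integral>\<^sup>+t. indicator U (snd (snd z) * t) \<partial>p (fst z)) * indicator K (fst (snd z)) \<partial>Q)"
      by (rule nn_integral_cong_AE)
        (use AE_Pol_target_transfer[OF Q SC] in \<open>eventually_elim, auto simp: indicator_def\<close>)
    finally show "emeasure R (M \<times> K \<times> U) = \<dots>" .
  qed
  then show ?thesis by (rule that)
qed

section \<open>Associativity\<close>

text \<open>
  Integration against the product: the part of \<open>R\<close> over \<open>M\<close> is obtained by drawing \<open>(b, c, s)\<close> from
  \<open>Q\<close> and then \<open>t\<close> from the fibre \<open>p b\<close>. The product formula is this identity on rectangles
  \<open>K \<times> S\<close>, and both sides are finite measures.
\<close>

lemma nn_integral_pol_product_target:
  assumes A: "finite_measure A" and B: "finite_measure B" and C: "finite_measure C"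
    and P: "P \<in> Pol A B" and Q: "Q \<in> Pol B C" and R: "is_pol_product A B C Q P R"
    and M[measurable]: "M \<in> sets A" and p: "target_fibres B P M p"
    and h[measurable]: "(\<lambda>(c, v). h c v) \<in> borel_measurable (C \<Otimes>\<^sub>M pos_reals)"
  shows "(\<integral>\<^sup>+z. h (fst (snd z)) (snd (snd z)) * indicator M (fst z) \<partial>R)
      = (\<integral>\<^sup>+z. \<integral>\<^sup>+t. h (fst (snd z)) (snd (snd z) * t) \<partial>p (fst z) \<partial>Q)"
proof -
  have RP: "R \<in> Pol A C" using R by (simp add: is_pol_product_def)
  note sR[measurable_cong] = sets_Pol[OF RP] and sQ[measurable_cong] = sets_Pol[OF Q]
  interpret R: finite_measure R by (rule finite_measure_Pol[OF RP A])
  note pk = target_fibres_kernel[OF p]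
  define \<nu> where "\<nu> = distr (density R (\<lambda>z. indicator M (fst z))) (C \<Otimes>\<^sub>M pos_reals) snd"
  have \<nu>I: "(\<integral>\<^sup>+y. f y \<partial>\<nu>) = (\<integral>\<^sup>+z. indicator M (fst z) * f (snd z) \<partial>R)"
    if [measurable]: "f \<in> borel_measurable (C \<Otimes>\<^sub>M pos_reals)" for f
    unfolding \<nu>_def by (subst nn_integral_distr, measurable, rule nn_integral_density) measurable
  obtain \<nu>' where s\<nu>': "sets \<nu>' = sets (C \<Otimes>\<^sub>M pos_reals)"
    and \<nu>'I: "\<And>f. f \<in> borel_measurable (C \<Otimes>\<^sub>M pos_reals) \<Longrightarrow>
      (\<integral>\<^sup>+y. f y \<partial>\<nu>') = (\<integral>\<^sup>+z. \<integral>\<^sup>+t. f (fst (snd z), snd (snd z) * t) \<partial>p (fst z) \<partial>Q)"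
    by (rule kernel_image_measure[OF pk, of fst "B \<Otimes>\<^sub>M C \<Otimes>\<^sub>M pos_reals"
          "\<lambda>z t. (fst (snd z), snd (snd z) * t)" "C \<Otimes>\<^sub>M pos_reals" Q])
      (measurable, rule sQ, blast)
  have "\<nu> = \<nu>'"
  proof (rule measure_eq_on_rectangles)
    show s\<nu>: "sets \<nu> = sets (C \<Otimes>\<^sub>M pos_reals)" by (simp add: \<nu>_def)
    then have e: "emeasure \<nu> X = (\<integral>\<^sup>+z. indicator M (fst z) * indicator X (snd z) \<partial>R)"
      if "X \<in> sets (C \<Otimes>\<^sub>M pos_reals)" for X
      using \<nu>I[of "indicator X"] that by simp
    have "space \<nu> \<in> sets (C \<Otimes>\<^sub>M pos_reals)" using s\<nu> by (metis sets.top)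
    then have "emeasure \<nu> (space \<nu>) \<le> (\<integral>\<^sup>+z. 1 \<partial>R)"
      by (subst e, assumption, intro nn_integral_mono) (auto simp: indicator_def)
    then show "finite_measure \<nu>"
      using R.emeasure_finite by (intro finite_measureI) (auto simp: top_unique)
    fix K S assume K[measurable]: "K \<in> sets C" and S[measurable]: "S \<in> sets pos_reals"
    obtain q where q: "source_fibres B Q K q" by (rule source_fibres_exist[OF Q B K])
    have "emeasure \<nu> (K \<times> S) = emeasure R (M \<times> K \<times> S)"
      unfolding emeasure_Pol_rectangle[OF RP M K S]
      by (subst e) (auto simp: indicator_def intro!: nn_integral_cong)
    also have "\<dots> = (\<integral>\<^sup>+z. (\<integral>\<^sup>+t. indicator S (snd (snd z) * t) \<partial>p (fst z)) * indicator K (fst (snd z)) \<partial>Q)"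
      unfolding is_pol_product_fibres[OF B C P Q R M K S p q] nn_integral_convolution_of_fibres(1)[OF p q S] ..
    also have "\<dots> = (\<integral>\<^sup>+z. \<integral>\<^sup>+t. indicator (K \<times> S) (fst (snd z), snd (snd z) * t) \<partial>p (fst z) \<partial>Q)"
      by (intro nn_integral_cong) (auto simp: indicator_def)
    also have "\<dots> = (\<integral>\<^sup>+y. indicator (K \<times> S) y \<partial>\<nu>')"
      by (rule \<nu>'I[symmetric]) measurable
    finally show "emeasure \<nu> (K \<times> S) = emeasure \<nu>' (K \<times> S)" by (simp add: s\<nu>')
  qed (rule s\<nu>')
  then show ?thesis
    using \<nu>I[OF h] \<nu>'I[OF h] by (simp add: split_beta' mult.commute)
qed

text \<open>
  The mirror image of the preceding lemma: the part of \<open>R\<close> over \<open>K\<close> is obtained by drawing \<open>(a, b, t)\<close> from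
  \<open>P\<close> and then \<open>s\<close> from the fibre \<open>q b\<close>.
\<close>

lemma nn_integral_pol_product_source:
  assumes A: "finite_measure A" and B: "finite_measure B" and C: "finite_measure C"
    and P: "P \<in> Pol A B" and Q: "Q \<in> Pol B C" and R: "is_pol_product A B C Q P R"
    and K[measurable]: "K \<in> sets C" and q: "source_fibres B Q K q"
    and h[measurable]: "(\<lambda>(a, v). h a v) \<in> borel_measurable (A \<Otimes>\<^sub>M pos_reals)"
  shows "(\<integral>\<^sup>+z. h (fst z) (snd (snd z)) * indicator K (fst (snd z)) \<partial>R)
      = (\<integral>\<^sup>+z. \<integral>\<^sup>+s. h (fst z) (s * snd (snd z)) \<partial>q (fst (snd z)) \<partial>P)"
proof -
  have RP: "R \<in> Pol A C" using R by (simp add: is_pol_product_def)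
  note sR[measurable_cong] = sets_Pol[OF RP] and sP[measurable_cong] = sets_Pol[OF P]
  interpret R: finite_measure R by (rule finite_measure_Pol[OF RP A])
  note qk = source_fibres_kernel[OF q]
  define \<nu> where "\<nu> = distr (density R (\<lambda>z. indicator K (fst (snd z)))) (A \<Otimes>\<^sub>M pos_reals) (\<lambda>z. (fst z, snd (snd z)))"
  have \<nu>I: "(\<integral>\<^sup>+y. f y \<partial>\<nu>) = (\<integral>\<^sup>+z. indicator K (fst (snd z)) * f (fst z, snd (snd z)) \<partial>R)"
    if [measurable]: "f \<in> borel_measurable (A \<Otimes>\<^sub>M pos_reals)" for f
    unfolding \<nu>_def by (subst nn_integral_distr, measurable, rule nn_integral_density) measurable
  obtain \<nu>' where s\<nu>': "sets \<nu>' = sets (A \<Otimes>\<^sub>M pos_reals)"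
    and \<nu>'I: "\<And>f. f \<in> borel_measurable (A \<Otimes>\<^sub>M pos_reals) \<Longrightarrow>
      (\<integral>\<^sup>+y. f y \<partial>\<nu>') = (\<integral>\<^sup>+z. \<integral>\<^sup>+s. f (fst z, s * snd (snd z)) \<partial>q (fst (snd z)) \<partial>P)"
    by (rule kernel_image_measure[OF qk, of "\<lambda>z. fst (snd z)" "A \<Otimes>\<^sub>M B \<Otimes>\<^sub>M pos_reals"
          "\<lambda>z s. (fst z, s * snd (snd z))" "A \<Otimes>\<^sub>M pos_reals" P])
      (measurable, rule sP, blast)
  have "\<nu> = \<nu>'"
  proof (rule measure_eq_on_rectangles)
    show s\<nu>: "sets \<nu> = sets (A \<Otimes>\<^sub>M pos_reals)" by (simp add: \<nu>_def)
    then have e: "emeasure \<nu> X = (\<integral>\<^sup>+z. indicator K (fst (snd z)) * indicator X (fst z, snd (snd z)) \<partial>R)"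
      if "X \<in> sets (A \<Otimes>\<^sub>M pos_reals)" for X
      using \<nu>I[of "indicator X"] that by simp
    have "space \<nu> \<in> sets (A \<Otimes>\<^sub>M pos_reals)" using s\<nu> by (metis sets.top)
    then have "emeasure \<nu> (space \<nu>) \<le> (\<integral>\<^sup>+z. 1 \<partial>R)"
      by (subst e, assumption, intro nn_integral_mono) (auto simp: indicator_def)
    then show "finite_measure \<nu>"
      using R.emeasure_finite by (intro finite_measureI) (auto simp: top_unique)
    fix M S assume M[measurable]: "M \<in> sets A" and S[measurable]: "S \<in> sets pos_reals"
    obtain p where p: "target_fibres B P M p" by (rule target_fibres_exist[OF P A B M])
    have "emeasure \<nu> (M \<times> S) = emeasure R (M \<times> K \<times> S)"
      unfolding emeasure_Pol_rectangle[OF RP M K S]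
      by (subst e) (auto simp: indicator_def intro!: nn_integral_cong)
    also have "\<dots> = (\<integral>\<^sup>+z. (\<integral>\<^sup>+s. indicator S (s * snd (snd z)) \<partial>q (fst (snd z))) * indicator M (fst z) \<partial>P)"
      unfolding is_pol_product_fibres[OF B C P Q R M K S p q] nn_integral_convolution_of_fibres(2)[OF p q S] ..
    also have "\<dots> = (\<integral>\<^sup>+z. \<integral>\<^sup>+s. indicator (M \<times> S) (fst z, s * snd (snd z)) \<partial>q (fst (snd z)) \<partial>P)"
      by (intro nn_integral_cong) (auto simp: indicator_def)
    also have "\<dots> = (\<integral>\<^sup>+y. indicator (M \<times> S) y \<partial>\<nu>')"
      by (rule \<nu>'I[symmetric]) measurable
    finally show "emeasure \<nu> (M \<times> S) = emeasure \<nu>' (M \<times> S)" by (simp add: s\<nu>')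
  qed (rule s\<nu>')
  then show ?thesis
    using \<nu>I[OF h] \<nu>'I[OF h] by (simp add: split_beta' mult.commute)
qed

text \<open>
  Both sides equal the integral, over \<open>(b, c, s)\<close> drawn from \<open>Q\<close>, of the mass that the distribution of \<open>u s t\<close>
  gives to \<open>S\<close>, where \<open>t\<close> has the law \<open>p b\<close> and \<open>u\<close> the law \<open>\<tau> c\<close>. The two bracketings differ in the order of
  integration over \<open>t\<close> and \<open>u\<close> and in the bracketing of the product \<open>u s t\<close>.
\<close>

lemma is_pol_product_assoc:
  assumes A: "finite_measure A" and B: "finite_measure B" and C: "finite_measure C" and D: "finite_measure D"
    and P: "P \<in> Pol A B" and Q: "Q \<in> Pol B C" and T: "T \<in> Pol C D"
    and TQ: "is_pol_product B C D T Q X" and QP: "is_pol_product A B C Q P Y"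
    and R: "is_pol_product A B D X P R" and R': "is_pol_product A C D T Y R'"
  shows "R = R'"
proof (rule measure_eq_on_triple_rectangles)
  have X: "X \<in> Pol B D" and Y: "Y \<in> Pol A C" and RP: "R \<in> Pol A D" "R' \<in> Pol A D"
    using TQ QP R R' by (simp_all add: is_pol_product_def)
  show "sets R = sets (A \<Otimes>\<^sub>M D \<Otimes>\<^sub>M pos_reals)" "sets R' = sets (A \<Otimes>\<^sub>M D \<Otimes>\<^sub>M pos_reals)"
    using RP by (simp_all add: sets_Pol)
  show "finite_measure R" by (rule finite_measure_Pol[OF RP(1) A])
  fix M L S assume M[measurable]: "M \<in> sets A" and L[measurable]: "L \<in> sets D" and S[measurable]: "S \<in> sets pos_reals"
  obtain p where p: "target_fibres B P M p" by (rule target_fibres_exist[OF P A B M])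
  obtain y where y: "target_fibres C Y M y" by (rule target_fibres_exist[OF Y A C M])
  obtain \<tau> where \<tau>: "source_fibres C T L \<tau>" by (rule source_fibres_exist[OF T C L])
  obtain x where x: "source_fibres B X L x" by (rule source_fibres_exist[OF X B L])
  note pk = target_fibres_kernel[OF p] and \<tau>k = source_fibres_kernel[OF \<tau>]
  have "emeasure R (M \<times> L \<times> S)
      = (\<integral>\<^sup>+z. (\<integral>\<^sup>+t. indicator S (snd (snd z) * t) \<partial>p (fst z)) * indicator L (fst (snd z)) \<partial>X)"
    unfolding is_pol_product_fibres[OF B D P X R M L S p x] by (rule nn_integral_convolution_of_fibres(1)[OF p x S])
  also have "\<dots> = (\<integral>\<^sup>+z. \<integral>\<^sup>+u. \<integral>\<^sup>+t. indicator S (u * snd (snd z) * t) \<partial>p (fst z) \<partial>\<tau> (fst (snd z)) \<partial>Q)"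
  proof (rule nn_integral_pol_product_source[OF B C D Q T TQ L \<tau>])
    show "(\<lambda>(b, v). \<integral>\<^sup>+t. indicator S (v * t) \<partial>p b) \<in> borel_measurable (B \<Otimes>\<^sub>M pos_reals)"
      unfolding split_beta' by (rule measurable_nn_integral_finite_kernel[OF pk]) measurable
  qed
  also have "\<dots> = (\<integral>\<^sup>+z. \<integral>\<^sup>+t. \<integral>\<^sup>+u. indicator S (u * (snd (snd z) * t)) \<partial>\<tau> (fst (snd z)) \<partial>p (fst z) \<partial>Q)"
  proof (rule nn_integral_cong)
    fix z assume "z \<in> space Q"
    then have z: "fst z \<in> space B" "fst (snd z) \<in> space C" "snd (snd z) \<in> space pos_reals"
      by (auto simp: space_Pol[OF Q])
    have [measurable]: "(\<lambda>_. snd (snd z)) \<in> W \<rightarrow>\<^sub>M pos_reals" for W :: "(real \<times> real) measure"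
      by (rule measurable_const[OF z(3)])
    show "(\<integral>\<^sup>+u. \<integral>\<^sup>+t. indicator S (u * snd (snd z) * t) \<partial>p (fst z) \<partial>\<tau> (fst (snd z)))
        = (\<integral>\<^sup>+t. \<integral>\<^sup>+u. indicator S (u * (snd (snd z) * t)) \<partial>\<tau> (fst (snd z)) \<partial>p (fst z))"
      unfolding mult.assoc
      by (rule nn_integral_finite_kernel_swap[OF \<tau>k z(2) pk z(1)]) (unfold split_beta', measurable)
  qed
  also have "\<dots> = (\<integral>\<^sup>+z. (\<integral>\<^sup>+u. indicator S (u * snd (snd z)) \<partial>\<tau> (fst (snd z))) * indicator M (fst z) \<partial>Y)"
  proof (rule nn_integral_pol_product_target[OF A B C P Q QP M p, symmetric])
    show "(\<lambda>(c, v). \<integral>\<^sup>+u. indicator S (u * v) \<partial>\<tau> c) \<in> borel_measurable (C \<Otimes>\<^sub>M pos_reals)"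
      unfolding split_beta' by (rule measurable_nn_integral_finite_kernel[OF \<tau>k]) measurable
  qed
  also have "\<dots> = emeasure R' (M \<times> L \<times> S)"
    unfolding is_pol_product_fibres[OF C D Y T R' M L S y \<tau>]
    by (rule nn_integral_convolution_of_fibres(2)[OF y \<tau> S, symmetric])
  finally show "emeasure R (M \<times> L \<times> S) = emeasure R' (M \<times> L \<times> S)" .
qed

lemma is_pol_product_pol_product:
  assumes "finite_measure A" "finite_measure B" "lebesgue_measure_space C" "P \<in> Pol A B" "Q \<in> Pol B C"
  shows "is_pol_product A B C Q P (pol_product A B C Q P)"
proof -
  have C: "finite_measure C" using assms(3) by (simp add: lebesgue_measure_space_def)
  obtain R where R: "is_pol_product A B C Q P R" by (rule is_pol_product_exists[OF assms])
  show ?thesis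
    unfolding pol_product_def
    by (rule theI[of "is_pol_product A B C Q P", OF R]) (rule is_pol_product_unique[OF assms(1,2) C assms(4,5) _ R])
qed

theorem theorem5p5:
  fixes A :: "'a measure" and B :: "'b measure" and C :: "'c measure" and D :: "'d measure"
    and P :: "('a \<times> 'b \<times> real) measure"
    and Q :: "('b \<times> 'c \<times> real) measure"
    and T :: "('c \<times> 'd \<times> real) measure"
  assumes "lebesgue_measure_space A" and "lebesgue_measure_space B"
    and "lebesgue_measure_space C" and "lebesgue_measure_space D"
    and "P \<in> Pol A B" and "Q \<in> Pol B C" and "T \<in> Pol C D"
  shows "pol_product A B D (pol_product B C D T Q) P =
         pol_product A C D T (pol_product A B C Q P)"
proof -
  have fin: "finite_measure A" "finite_measure B" "finite_measure C" "finite_measure D"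
    using assms(1-4) by (simp_all add: lebesgue_measure_space_def)
  have TQ: "is_pol_product B C D T Q (pol_product B C D T Q)"
    and QP: "is_pol_product A B C Q P (pol_product A B C Q P)"
    using assms fin by (simp_all add: is_pol_product_pol_product)
  then have "pol_product B C D T Q \<in> Pol B D" "pol_product A B C Q P \<in> Pol A C"
    by (simp_all add: is_pol_product_def)
  then have "is_pol_product A B D (pol_product B C D T Q) P (pol_product A B D (pol_product B C D T Q) P)"
    "is_pol_product A C D T (pol_product A B C Q P) (pol_product A C D T (pol_product A B C Q P))"
    using assms fin by (simp_all add: is_pol_product_pol_product)
  then show ?thesis
    by (rule is_pol_product_assoc[OF fin assms(5-7) TQ QP])
qed

end
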